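(* Let $C$ be a coalgebra over a field $\mathbb{K}$, with coradical $C_0$. Let $(x^n)_{n}$ be a sequence of elements of $C$ such that the sequence $(lw(x^n))_n$ is unbounded. Then there is $a^*\in C^*$ such that $a^*\in C_0^\perp$ and $(lw(a^*\cdot x^n))_n$ is unbounded.
   Context: The dual $C^*$ acts on $C$ by $c^*\cdot x=\sum x_1c^*(x_2)$ and $x\cdot c^*=\sum c^*(x_1)x_2$, where $\Delta(x)=\sum x_1\otimes x_2$. The coradical filtration $C_0\subseteq C_1\subseteq\cdots$ of $C$: $C_0$ is the socle of $C$ as a left (equivalently right) $C^*$-module, and inductively $C_n/C_{n-1}$ is the socle of $C/C_{n-1}$ as a left (equivalently right) $C^*$-module. One has $\bigcup_nC_n=C$, and we put $C_{-1}=0$. For $x\in C$, $lw(x)$ denotes the Loewy length of the finite dimensional subcoalgebra $C^*\cdot x\cdot C^*$ generated by $x$ (equal to that of $C^*\cdot x$ and of $x\cdot C^*$). Concretely, $lw(x)=n+1$ if and only if $x\in C_n\setminus C_{n-1}$ ($n\ge0$), and $lw(0)=0$. For $X\subseteq C$, $X^\perp=\{c^*\in C^*\mid c^*(X)=0\}$. (The superscript in $x^n$ is an index, not a power.) *)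

theory Defs
  imports Complex_Main "HOL-Library.Poly_Mapping"
begin

section \<open>Tensor powers\<close>

text \<open>
  The type \<open>'x \<Rightarrow>\<^sub>0 'k\<close> is the free \<open>'k\<close>-vector space on \<open>'x\<close>, with scalar multiplication
  \<open>fscale\<close>; \<open>lin_ext scale \<phi>\<close> is the linear extension of \<open>\<phi>\<close> from basis elements to that space.
\<close>

definition fscale :: "'k::field \<Rightarrow> ('x \<Rightarrow>\<^sub>0 'k) \<Rightarrow> ('x \<Rightarrow>\<^sub>0 'k)"
  where "fscale k p = Poly_Mapping.map (\<lambda>c. k * c) p"

definition lin_ext :: "('k::field \<Rightarrow> 'v::ab_group_add \<Rightarrow> 'v) \<Rightarrow> ('x \<Rightarrow> 'v) \<Rightarrow> ('x \<Rightarrow>\<^sub>0 'k) \<Rightarrow> 'v"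
  where "lin_ext scale \<phi> p = (\<Sum>x\<in>Poly_Mapping.keys p. scale (Poly_Mapping.lookup p x) (\<phi> x))"

text \<open>
  For a vector space \<open>C\<close> (a type with scalar multiplication \<open>scale\<close>), \<open>C \<otimes> C\<close> is the quotient of the
  free space on \<open>C \<times> C\<close> by \<open>tensor2_null\<close>; similarly \<open>C \<otimes> C \<otimes> C\<close> is the quotient of the free space
  on triples by \<open>tensor3_null\<close>. The basis element of \<open>(a, b)\<close> represents \<open>a \<otimes> b\<close>. As the scalar
  multiplication is a parameter, these quotients are not types, and an element of \<open>C \<otimes> C\<close> is a
  coset \<open>tensor2 scale p\<close>.
\<close>

definition tensor2_null ::
  "('k::field \<Rightarrow> 'c::ab_group_add \<Rightarrow> 'c) \<Rightarrow> ('c \<times> 'c \<Rightarrow>\<^sub>0 'k) set"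
  where "tensor2_null scale = module.span fscale
    ({Poly_Mapping.single (a + a', b) 1 - Poly_Mapping.single (a, b) 1
        - Poly_Mapping.single (a', b) 1 | a a' b. True}
     \<union> {Poly_Mapping.single (a, b + b') 1 - Poly_Mapping.single (a, b) 1
        - Poly_Mapping.single (a, b') 1 | a b b'. True}
     \<union> {Poly_Mapping.single (scale k a, b) 1 - Poly_Mapping.single (a, b) k | k a b. True}
     \<union> {Poly_Mapping.single (a, scale k b) 1 - Poly_Mapping.single (a, b) k | k a b. True})"

definition tensor3_null ::
  "('k::field \<Rightarrow> 'c::ab_group_add \<Rightarrow> 'c) \<Rightarrow> ('c \<times> 'c \<times> 'c \<Rightarrow>\<^sub>0 'k) set"
  where "tensor3_null scale = module.span fscale
    ({Poly_Mapping.single (a + a', b, c) 1 - Poly_Mapping.single (a, b, c) 1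
        - Poly_Mapping.single (a', b, c) 1 | a a' b c. True}
     \<union> {Poly_Mapping.single (a, b + b', c) 1 - Poly_Mapping.single (a, b, c) 1
        - Poly_Mapping.single (a, b', c) 1 | a b b' c. True}
     \<union> {Poly_Mapping.single (a, b, c + c') 1 - Poly_Mapping.single (a, b, c) 1
        - Poly_Mapping.single (a, b, c') 1 | a b c c'. True}
     \<union> {Poly_Mapping.single (scale k a, b, c) 1 - Poly_Mapping.single (a, b, c) k | k a b c. True}
     \<union> {Poly_Mapping.single (a, scale k b, c) 1 - Poly_Mapping.single (a, b, c) k | k a b c. True}
     \<union> {Poly_Mapping.single (a, b, scale k c) 1 - Poly_Mapping.single (a, b, c) k | k a b c. True})"

definition tensor2 ::
  "('k::field \<Rightarrow> 'c::ab_group_add \<Rightarrow> 'c) \<Rightarrow> ('c \<times> 'c \<Rightarrow>\<^sub>0 'k) \<Rightarrow> ('c \<times> 'c \<Rightarrow>\<^sub>0 'k) set"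
  where "tensor2 scale p = {q. q - p \<in> tensor2_null scale}"

section \<open>Coalgebras\<close>

text \<open>
  The comultiplication \<open>\<Delta>\<close> takes values in \<open>C \<otimes> C\<close>, so \<open>p \<in> \<Delta> x\<close> says that the formal sum \<open>p\<close> is one of
  the ways to write \<open>\<Delta>(x) = \<Sum> x\<^sub>1 \<otimes> x\<^sub>2\<close>. In \<open>coassoc\<close> both \<open>p\<close> and the function \<open>r\<close> choosing a formal
  sum for each \<open>\<Delta>(y)\<close> are arbitrary; the two terms represent \<open>(\<Delta> \<otimes> id)(\<Delta>(x))\<close> and
  \<open>(id \<otimes> \<Delta>)(\<Delta>(x))\<close>.
\<close>

locale coalgebra = vector_space scale
  for scale :: "'k::field \<Rightarrow> 'c::ab_group_add \<Rightarrow> 'c" +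
  fixes \<Delta> :: "'c \<Rightarrow> ('c \<times> 'c \<Rightarrow>\<^sub>0 'k) set"
    and \<epsilon> :: "'c \<Rightarrow> 'k"
  assumes comult_tensor: "\<Delta> x \<in> range (tensor2 scale)"
    and comult_add: "p \<in> \<Delta> x \<Longrightarrow> q \<in> \<Delta> y \<Longrightarrow> p + q \<in> \<Delta> (x + y)"
    and comult_scale: "p \<in> \<Delta> x \<Longrightarrow> fscale k p \<in> \<Delta> (scale k x)"
    and coassoc: "p \<in> \<Delta> x \<Longrightarrow> (\<And>y. r y \<in> \<Delta> y) \<Longrightarrow>
      lin_ext fscale (\<lambda>(a, b). lin_ext fscale (\<lambda>(y, z). Poly_Mapping.single (y, z, b) 1) (r a)) p
      - lin_ext fscale (\<lambda>(a, b). lin_ext fscale (\<lambda>(y, z). Poly_Mapping.single (a, y, z) 1) (r b)) p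
      \<in> tensor3_null scale"
    and counit_linear: "Vector_Spaces.linear scale (*) \<epsilon>"
    and counit_left: "p \<in> \<Delta> x \<Longrightarrow> lin_ext scale (\<lambda>(a, b). scale (\<epsilon> a) b) p = x"
    and counit_right: "p \<in> \<Delta> x \<Longrightarrow> lin_ext scale (\<lambda>(a, b). scale (\<epsilon> b) a) p = x"

definition dual :: "('k::field \<Rightarrow> 'c::ab_group_add \<Rightarrow> 'c) \<Rightarrow> ('c \<Rightarrow> 'k) set"
  where "dual scale = {f. Vector_Spaces.linear scale (*) f}"

definition perp :: "('k::field \<Rightarrow> 'c::ab_group_add \<Rightarrow> 'c) \<Rightarrow> 'c set \<Rightarrow> ('c \<Rightarrow> 'k) set"
  where "perp scale X = {f \<in> dual scale. \<forall>x\<in>X. f x = 0}"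

text \<open>
  \<open>lact scale \<Delta> f x\<close> is \<open>f \<cdot> x = \<Sum> x\<^sub>1 f(x\<^sub>2)\<close> and \<open>ract scale \<Delta> f x\<close> is \<open>x \<cdot> f = \<Sum> f(x\<^sub>1) x\<^sub>2\<close>. For \<open>f\<close> in
  the dual the choice of the formal sum is immaterial, see \<open>lact_eq\<close> and \<open>ract_eq\<close> below.
\<close>

definition lact ::
  "('k::field \<Rightarrow> 'c::ab_group_add \<Rightarrow> 'c) \<Rightarrow> ('c \<Rightarrow> ('c \<times> 'c \<Rightarrow>\<^sub>0 'k) set) \<Rightarrow> ('c \<Rightarrow> 'k) \<Rightarrow> 'c \<Rightarrow> 'c"
  where "lact scale \<Delta> f x = lin_ext scale (\<lambda>(a, b). scale (f b) a) (SOME p. p \<in> \<Delta> x)"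

definition ract ::
  "('k::field \<Rightarrow> 'c::ab_group_add \<Rightarrow> 'c) \<Rightarrow> ('c \<Rightarrow> ('c \<times> 'c \<Rightarrow>\<^sub>0 'k) set) \<Rightarrow> ('c \<Rightarrow> 'k) \<Rightarrow> 'c \<Rightarrow> 'c"
  where "ract scale \<Delta> f x = lin_ext scale (\<lambda>(a, b). scale (f a) b) (SOME p. p \<in> \<Delta> x)"

section \<open>Socles and Loewy series of modules\<close>

text \<open>
  A left module is given by its carrier, its addition and zero, the carrier of the acting ring and
  the action. The carrier has to be a set since quotients and submodules are formed. Closure under
  negation is not listed in \<open>submod\<close>: the acting rings contain \<open>-1\<close> (for the dual of a coalgebra this
  is \<open>-\<epsilon>\<close>).
\<close>

record ('r, 'm) lmodule =
  mcarrier :: "'m set"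
  madd :: "'m \<Rightarrow> 'm \<Rightarrow> 'm"
  mzero :: 'm
  mscalars :: "'r set"
  mact :: "'r \<Rightarrow> 'm \<Rightarrow> 'm"

definition submod :: "('r, 'm) lmodule \<Rightarrow> 'm set \<Rightarrow> bool"
  where "submod M N \<longleftrightarrow> N \<subseteq> mcarrier M \<and> mzero M \<in> N \<and>
    (\<forall>x\<in>N. \<forall>y\<in>N. madd M x y \<in> N) \<and> (\<forall>r\<in>mscalars M. \<forall>x\<in>N. mact M r x \<in> N)"

definition simple_submod :: "('r, 'm) lmodule \<Rightarrow> 'm set \<Rightarrow> bool"
  where "simple_submod M S \<longleftrightarrow> submod M S \<and> S \<noteq> {mzero M} \<and>
    (\<forall>T. submod M T \<and> T \<subseteq> S \<longrightarrow> T = {mzero M} \<or> T = S)"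

text \<open>The socle is the sum, i.e. the least submodule containing all, of the simple submodules.\<close>

definition socle :: "('r, 'm) lmodule \<Rightarrow> 'm set"
  where "socle M = \<Inter>{N. submod M N \<and> (\<forall>S. simple_submod M S \<longrightarrow> S \<subseteq> N)}"

definition mcoset :: "('r, 'm) lmodule \<Rightarrow> 'm set \<Rightarrow> 'm \<Rightarrow> 'm set"
  where "mcoset M L x = {madd M x l | l. l \<in> L}"

definition quot_module :: "('r, 'm) lmodule \<Rightarrow> 'm set \<Rightarrow> ('r, 'm set) lmodule"
  where "quot_module M L =
    \<lparr>mcarrier = mcoset M L ` mcarrier M,
     madd = (\<lambda>A B. {madd M a b | a b. a \<in> A \<and> b \<in> B}),
     mzero = L,
     mscalars = mscalars M,
     mact = (\<lambda>r A. {madd M (mact M r a) l | a l. a \<in> A \<and> l \<in> L})\<rparr>"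

text \<open>
  \<open>loewy_series M (n + 1)\<close> contains \<open>loewy_series M n\<close>, with quotient the socle of
  \<open>M / loewy_series M n\<close>.
\<close>

fun loewy_series :: "('r, 'm) lmodule \<Rightarrow> nat \<Rightarrow> 'm set"
  where
    "loewy_series M 0 = {mzero M}"
  | "loewy_series M (Suc n) = {x \<in> mcarrier M.
       mcoset M (loewy_series M n) x \<in> socle (quot_module M (loewy_series M n))}"

definition loewy_length :: "('r, 'm) lmodule \<Rightarrow> nat"
  where "loewy_length M = (LEAST n. loewy_series M n = mcarrier M)"

section \<open>Coradical and Loewy length of elements\<close>

text \<open>
  \<open>left_module scale \<Delta> D\<close> is a left \<open>C\<^sup>*\<close>-submodule \<open>D\<close> of \<open>C\<close>, as a module in its own right. The
  coradical filtration \<open>C\<^sub>n\<close> is \<open>loewy_series (left_module scale \<Delta> UNIV) (n + 1)\<close>.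
\<close>

definition left_module ::
  "('k::field \<Rightarrow> 'c::ab_group_add \<Rightarrow> 'c) \<Rightarrow> ('c \<Rightarrow> ('c \<times> 'c \<Rightarrow>\<^sub>0 'k) set) \<Rightarrow> 'c set
    \<Rightarrow> ('c \<Rightarrow> 'k, 'c) lmodule"
  where "left_module scale \<Delta> D =
    \<lparr>mcarrier = D, madd = (+), mzero = 0, mscalars = dual scale, mact = lact scale \<Delta>\<rparr>"

definition coradical ::
  "('k::field \<Rightarrow> 'c::ab_group_add \<Rightarrow> 'c) \<Rightarrow> ('c \<Rightarrow> ('c \<times> 'c \<Rightarrow>\<^sub>0 'k) set) \<Rightarrow> 'c set"
  where "coradical scale \<Delta> = socle (left_module scale \<Delta> UNIV)"

text \<open>The subcoalgebra \<open>C\<^sup>* \<cdot> x \<cdot> C\<^sup>*\<close> generated by \<open>x\<close>.\<close>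

definition gen_subcoalgebra ::
  "('k::field \<Rightarrow> 'c::ab_group_add \<Rightarrow> 'c) \<Rightarrow> ('c \<Rightarrow> ('c \<times> 'c \<Rightarrow>\<^sub>0 'k) set) \<Rightarrow> 'c \<Rightarrow> 'c set"
  where "gen_subcoalgebra scale \<Delta> x = module.span scale
    {ract scale \<Delta> g (lact scale \<Delta> f x) | f g. f \<in> dual scale \<and> g \<in> dual scale}"

definition lw ::
  "('k::field \<Rightarrow> 'c::ab_group_add \<Rightarrow> 'c) \<Rightarrow> ('c \<Rightarrow> ('c \<times> 'c \<Rightarrow>\<^sub>0 'k) set) \<Rightarrow> 'c \<Rightarrow> nat"
  where "lw scale \<Delta> x = loewy_length (left_module scale \<Delta> (gen_subcoalgebra scale \<Delta> x))"

section \<open>Independence of the chosen formal sums\<close>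

lemma lookup_fscale: "Poly_Mapping.lookup (fscale k p) x = k * Poly_Mapping.lookup p x"
  by (simp add: fscale_def map.rep_eq when_def)

lemma vector_space_fscale: "vector_space fscale"
  by unfold_locales (auto intro!: poly_mapping_eqI simp: lookup_fscale lookup_add algebra_simps)

context vector_space
begin

lemma lin_ext_superset:
  assumes "finite A" "Poly_Mapping.keys p \<subseteq> A"
  shows "lin_ext scale \<phi> p = (\<Sum>x\<in>A. scale (Poly_Mapping.lookup p x) (\<phi> x))"
  unfolding lin_ext_def
  by (rule sum.mono_neutral_left) (use assms in \<open>auto simp: in_keys_iff\<close>)

lemma linear_lin_ext: "Vector_Spaces.linear fscale scale (lin_ext scale \<phi>)"
proof -
  interpret F: vector_space fscale by (rule vector_space_fscale)
  have add: "lin_ext scale \<phi> (p + q) = lin_ext scale \<phi> p + lin_ext scale \<phi> q" for p q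
  proof -
    let ?A = "Poly_Mapping.keys p \<union> Poly_Mapping.keys q"
    have "Poly_Mapping.keys (p + q) \<subseteq> ?A" by (rule Poly_Mapping.keys_add)
    then show ?thesis
      by (simp add: lin_ext_superset[where A = ?A] lookup_add scale_left_distrib sum.distrib)
  qed
  have scl: "lin_ext scale \<phi> (fscale k p) = scale k (lin_ext scale \<phi> p)" for k p
  proof -
    have "Poly_Mapping.keys (fscale k p) \<subseteq> Poly_Mapping.keys p"
      by (auto simp: in_keys_iff lookup_fscale)
    then show ?thesis
      by (simp add: lin_ext_superset[where A = "Poly_Mapping.keys p"] lookup_fscale scale_sum_right)
  qed
  show ?thesis by unfold_locales (simp_all add: add scl)
qed

lemma lin_ext_single: "lin_ext scale \<phi> (Poly_Mapping.single x k) = scale k (\<phi> x)"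
  by (auto simp: lin_ext_def)

lemma lin_ext_tensor2_null:
  assumes "\<And>a a' b. \<phi> (a + a', b) = \<phi> (a, b) + \<phi> (a', b)"
    and "\<And>a b b'. \<phi> (a, b + b') = \<phi> (a, b) + \<phi> (a, b')"
    and "\<And>k a b. \<phi> (scale k a, b) = scale k (\<phi> (a, b))"
    and "\<And>k a b. \<phi> (a, scale k b) = scale k (\<phi> (a, b))"
    and "p \<in> tensor2_null scale"
  shows "lin_ext scale \<phi> p = 0"
proof -
  interpret L: Vector_Spaces.linear fscale scale "lin_ext scale \<phi>" by (rule linear_lin_ext)
  show ?thesis
    using assms(5) unfolding tensor2_null_def
    by (rule L.eq_0_on_span[rotated]) (auto simp: L.diff lin_ext_single assms(1-4))
qed

end

context coalgebra
begin

lemma comult_diff: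
  assumes "p \<in> \<Delta> x" "q \<in> \<Delta> x"
  shows "p - q \<in> tensor2_null scale"
proof -
  interpret F: vector_space fscale by (rule vector_space_fscale)
  obtain r where r: "\<Delta> x = tensor2 scale r" using comult_tensor by blast
  have "p - r \<in> tensor2_null scale" "q - r \<in> tensor2_null scale"
    using assms r by (auto simp: tensor2_def)
  then have "(p - r) - (q - r) \<in> tensor2_null scale"
    unfolding tensor2_null_def by (rule F.span_diff)
  then show ?thesis by simp
qed

lemma comult_nonempty: "\<exists>p. p \<in> \<Delta> x"
proof -
  interpret F: vector_space fscale by (rule vector_space_fscale)
  obtain r where r: "\<Delta> x = tensor2 scale r" using comult_tensor by blast
  have "r \<in> \<Delta> x" unfolding r by (simp add: tensor2_def tensor2_null_def F.span_zero)
  then show ?thesis by blast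
qed

lemma lin_ext_comult:
  assumes "\<And>a a' b. \<phi> (a + a', b) = \<phi> (a, b) + \<phi> (a', b)"
    and "\<And>a b b'. \<phi> (a, b + b') = \<phi> (a, b) + \<phi> (a, b')"
    and "\<And>k a b. \<phi> (scale k a, b) = scale k (\<phi> (a, b))"
    and "\<And>k a b. \<phi> (a, scale k b) = scale k (\<phi> (a, b))"
    and "p \<in> \<Delta> x" "q \<in> \<Delta> x"
  shows "lin_ext scale \<phi> p = lin_ext scale \<phi> q"
proof -
  interpret L: Vector_Spaces.linear fscale scale "lin_ext scale \<phi>" by (rule linear_lin_ext)
  have "lin_ext scale \<phi> (p - q) = 0"
    using lin_ext_tensor2_null[of \<phi>] assms comult_diff by blast
  then show ?thesis by (simp add: L.diff)
qed

lemma lact_eq: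
  assumes "f \<in> dual scale" "p \<in> \<Delta> x"
  shows "lact scale \<Delta> f x = lin_ext scale (\<lambda>(a, b). scale (f b) a) p"
proof -
  interpret f: Vector_Spaces.linear scale "(*)" f using assms(1) by (simp add: dual_def)
  show ?thesis unfolding lact_def
    by (rule lin_ext_comult[of _ _ x])
      (use assms(2) in \<open>auto simp: f.add f.scale algebra_simps intro: someI\<close>)
qed

lemma ract_eq:
  assumes "f \<in> dual scale" "p \<in> \<Delta> x"
  shows "ract scale \<Delta> f x = lin_ext scale (\<lambda>(a, b). scale (f a) b) p"
proof -
  interpret f: Vector_Spaces.linear scale "(*)" f using assms(1) by (simp add: dual_def)
  show ?thesis unfolding ract_def
    by (rule lin_ext_comult[of _ _ x])
      (use assms(2) in \<open>auto simp: f.add f.scale algebra_simps intro: someI\<close>)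
qed

end

end

theory Submission
  imports Defs
begin

text \<open>
  Write \<open>A\<close> for the dual algebra, \<open>J\<close> for the annihilator of the coradical in \<open>A\<close>, and \<open>F\<^sub>n\<close>
  (\<open>filtration n\<close>) for the elements of Loewy length at most \<open>n\<close>, i.e. \<open>F\<^sub>n = C\<^sub>n\<^sub>-\<^sub>1\<close>. The argument
  is of Baire category type. For \<open>a \<in> J\<close>, boundedness of the Loewy lengths of all \<open>a \<cdot> x\<^sup>n\<close> means
  that all \<open>a \<cdot> x\<^sup>n\<close> lie in one \<open>F\<^sub>N\<close>. Since \<open>h(a \<cdot> x) = a(x \<cdot> h)\<close> (\<open>pairing_lact_ract\<close>), this
  says that \<open>a\<close> vanishes on the span \<open>W\<^sub>N\<close> of all \<open>x\<^sup>n \<cdot> h\<close> with \<open>h\<close> vanishing on \<open>F\<^sub>N\<close>. So if the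
  statement fails, every functional that vanishes on the coradical also vanishes on some member
  of the decreasing chain \<open>W\<^sub>0 \<supseteq> W\<^sub>1 \<supseteq> \<dots>\<close>. Then one index works for all of them, and \<open>W\<^sub>N\<close> lies in
  the coradical (\<open>chain_below_if_dual_killed\<close>): otherwise vectors in ever smaller members of the
  chain are linearly independent modulo the coradical, and the functional that is 1 on all of
  them is a counterexample. Hence \<open>J \<cdot> x\<^sup>n \<subseteq> F\<^sub>N\<close>, and so \<open>x\<^sup>n \<in> F\<^sub>N\<^sub>+\<^sub>1\<close> (\<open>filtration_SucI\<close>), for all
  \<open>n\<close>, which bounds the Loewy lengths of the \<open>x\<^sup>n\<close>.

  To make the Loewy series accessible, the socle of \<open>D/L\<close> is described by left ideals: the class
  of \<open>x\<close> is in it if and only if \<open>{f \<in> A. f \<cdot> x \<in> L}\<close> contains a finite intersection of maximal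
  left ideals (\<open>socle_over_eq\<close>). This condition mentions \<open>D\<close> only through \<open>x \<in> D\<close>. Hence the
  Loewy series of any submodule \<open>D\<close> of \<open>C\<close> is the trace \<open>F\<^sub>n \<inter> D\<close> (\<open>loewy_series_eq\<close>), which
  turns the definition of \<open>lw\<close> through subcoalgebras into membership in \<open>F\<^sub>n\<close> (\<open>lw_le_iff\<close>). It
  also reduces the step from \<open>J \<cdot> x \<subseteq> F\<^sub>n\<close> to \<open>x \<in> F\<^sub>n\<^sub>+\<^sub>1\<close> to linear algebra, as the left ideal of
  \<open>x\<close> then contains all functionals vanishing on some finite-dimensional part of the coradical.
\<close>

section \<open>Linear functionals on a vector space\<close>

context vector_space
begin

text \<open>The relations spanning the null space are exactly what a trilinear map kills.\<close>

lemma lin_ext_tensor3_null: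
  assumes "\<And>a a' b c. \<phi> (a + a', b, c) = \<phi> (a, b, c) + \<phi> (a', b, c)"
    and "\<And>a b b' c. \<phi> (a, b + b', c) = \<phi> (a, b, c) + \<phi> (a, b', c)"
    and "\<And>a b c c'. \<phi> (a, b, c + c') = \<phi> (a, b, c) + \<phi> (a, b, c')"
    and "\<And>k a b c. \<phi> (scale k a, b, c) = scale k (\<phi> (a, b, c))"
    and "\<And>k a b c. \<phi> (a, scale k b, c) = scale k (\<phi> (a, b, c))"
    and "\<And>k a b c. \<phi> (a, b, scale k c) = scale k (\<phi> (a, b, c))"
    and "p \<in> tensor3_null scale"
  shows "lin_ext scale \<phi> p = 0"
proof -
  interpret L: Vector_Spaces.linear fscale scale "lin_ext scale \<phi>" by (rule linear_lin_ext)
  show ?thesis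
    using assms(7) unfolding tensor3_null_def
    by (rule L.eq_0_on_span[rotated]) (auto simp: L.diff lin_ext_single assms(1-6))
qed

lemma linear_image_lin_ext:
  assumes "Vector_Spaces.linear scale scale' g"
  shows "g (lin_ext scale \<phi> p) = lin_ext scale' (\<lambda>x. g (\<phi> x)) p"
proof -
  interpret g: Vector_Spaces.linear scale scale' g by (rule assms)
  show ?thesis by (simp add: lin_ext_def g.sum g.scale)
qed

lemma lin_ext_lin_ext_fscale:
  "lin_ext scale \<phi> (lin_ext fscale \<psi> p) = lin_ext scale (\<lambda>x. lin_ext scale \<phi> (\<psi> x)) p"
  by (rule vector_space.linear_image_lin_ext[OF vector_space_fscale linear_lin_ext])

lemma dual_independent_extend:
  fixes g :: "'b \<Rightarrow> 'a"
  assumes "independent B"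
  shows "\<exists>f \<in> dual scale. \<forall>b\<in>B. f b = g b"
proof -
  interpret P: vector_space_pair scale "(*) :: 'a \<Rightarrow> 'a \<Rightarrow> 'a"
    by unfold_locales (auto simp: algebra_simps)
  show ?thesis
    using P.linear_independent_extend[OF assms, of g] unfolding dual_def by blast
qed

lemma dual_zero_on_span:
  assumes "f \<in> dual scale" "\<And>b. b \<in> B \<Longrightarrow> f b = 0" "v \<in> span B"
  shows "f v = 0"
proof -
  interpret f: Vector_Spaces.linear scale "(*)" f using assms(1) by (simp add: dual_def)
  show ?thesis using f.eq_0_on_span assms by blast
qed

lemma dual_separates:
  assumes "subspace S" "v \<notin> S"
  shows "\<exists>f \<in> dual scale. (\<forall>s\<in>S. f s = 0) \<and> f v = 1"
proof -
  obtain B where B: "B \<subseteq> S" "independent B" "span B = S"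
    using assms(1) basis_exists[of S] span_minimal[OF _ assms(1)] by (metis subset_antisym)
  have "independent (insert v B)"
    using B assms(2) by (simp add: independent_insert)
  then obtain f where f: "f \<in> dual scale" "\<forall>b\<in>insert v B. f b = (if b = v then 1 else 0)"
    using dual_independent_extend[of _ "\<lambda>b. if b = v then 1 else 0"] by blast
  have "f b = 0" if "b \<in> B" for b using f(2) that B(1) assms(2) by auto
  then have "\<forall>s\<in>S. f s = 0" using dual_zero_on_span[OF f(1)] B(3) by blast
  then show ?thesis using f by auto
qed

text \<open>
  The annihilator of \<open>S \<inter> T\<close> is the sum of those of \<open>S\<close> and of \<open>T\<close>: here \<open>g\<close> is in the first and
  \<open>f - g\<close> in the second.
\<close>

lemma dual_split:
  assumes f: "f \<in> dual scale" and S: "subspace S" and T: "subspace T"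
    and 0: "\<And>v. v \<in> S \<Longrightarrow> v \<in> T \<Longrightarrow> f v = 0"
  shows "\<exists>g \<in> dual scale. (\<forall>s\<in>S. g s = 0) \<and> (\<forall>t\<in>T. g t = f t)"
proof -
  obtain B where B: "B \<subseteq> S" "independent B" "span B = S"
    using S basis_exists[of S] span_minimal[OF _ S] by (metis subset_antisym)
  \<comment> \<open>A basis of \<open>S\<close> is extended by vectors of \<open>T\<close>, on which \<open>g\<close> can be made to agree with \<open>f\<close>.\<close>
  obtain E where E: "B \<subseteq> E" "E \<subseteq> B \<union> T" "independent E" "B \<union> T \<subseteq> span E"
    using maximal_independent_subset_extend[of B "B \<union> T"] B(2) by auto
  obtain g where g: "g \<in> dual scale" "\<forall>b\<in>E. g b = (if b \<in> B then 0 else f b)"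
    using dual_independent_extend[OF E(3), of "\<lambda>b. if b \<in> B then 0 else f b"] by blast
  interpret f: Vector_Spaces.linear scale "(*)" f using f by (simp add: dual_def)
  interpret g: Vector_Spaces.linear scale "(*)" g using g by (simp add: dual_def)
  have gS: "g s = 0" if "s \<in> S" for s
    by (rule dual_zero_on_span[OF g(1), of B]) (use g(2) E(1) that B(3) in auto)
  have "g t = f t" if t: "t \<in> T" for t
  proof -
    have "t \<in> span (B \<union> (E - B))" using t E(1,4) by (auto simp: Un_absorb1)
    then obtain s t' where st: "t = s + t'" "s \<in> S" "t' \<in> span (E - B)"
      unfolding span_Un B(3) by blast
    have "span (E - B) \<subseteq> T" using E(2) T by (intro span_minimal) auto
    then have "s \<in> T" using subspace_diff[OF T t, of t'] st by auto
    then have s: "f s = 0" "g s = 0" using 0 st(2) gS by auto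
    have "g t' = f t'"
      using st(3)
    proof (induct rule: span_induct_alt)
      case base show ?case by (simp add: f.zero g.zero)
    next
      case (step c x y) then show ?case using g(2) by (simp add: f.add g.add f.scale g.scale)
    qed
    then show ?thesis using s st(1) by (simp add: f.add g.add)
  qed
  then show ?thesis using g(1) gS by blast
qed

lemma finite_spanning_subset:
  assumes "subspace S" "S \<subseteq> span B" "finite B"
  shows "\<exists>E. finite E \<and> E \<subseteq> S \<and> S = span E"
proof -
  obtain E where E: "E \<subseteq> S" "independent E" "span E = S"
    using assms(1) basis_exists[of S] span_minimal[OF _ assms(1)] by (metis subset_antisym)
  then show ?thesis using independent_span_bound[OF assms(3) E(2)] assms(2) by auto
qed

lemma dim_strict_mono:
  assumes "subspace S" "S \<subset> T" "T \<subseteq> span B" "finite B"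
  shows "dim S < dim T"
proof -
  obtain E where E: "E \<subseteq> S" "independent E" "S \<subseteq> span E" "card E = dim S"
    using basis_exists[of S] by auto
  obtain F where F: "F \<subseteq> T" "independent F" "T \<subseteq> span F" "card F = dim T"
    using basis_exists[of T] by auto
  have finF: "finite F" using independent_span_bound[OF assms(4) F(2)] F(1) assms(3) by auto
  obtain t where t: "t \<in> T" "t \<notin> S" using assms(2) by blast
  have "span E \<subseteq> S" using E(1) assms(1) by (rule span_minimal)
  then have tE: "t \<notin> span E" "t \<notin> E" using t E(1) by auto
  have "independent (insert t E)" using E(2) tE by (simp add: independent_insert)
  from independent_span_bound[OF finF this] have "finite (insert t E)" "card (insert t E) \<le> card F"
    using t(1) E(1) assms(2) F(3) by auto
  then show ?thesis using E(4) F(4) tE(2) by simp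
qed

text \<open>
  The algebraic dual is complete in its finite topology, and this is the corresponding Baire
  property: if the annihilator of \<open>S\<close> is the union of the closed subspaces formed by its
  elements vanishing on \<open>W n\<close>, then it equals one of them, which is what \<open>W n \<subseteq> S\<close> says.
\<close>

lemma chain_below_if_dual_killed:
  assumes W: "\<And>n. subspace (W n)" "\<And>n. W (Suc n) \<subseteq> W n"
    and S: "subspace S"
    and kill: "\<And>f. f \<in> dual scale \<Longrightarrow> (\<forall>s\<in>S. f s = 0) \<Longrightarrow> \<exists>n. \<forall>w\<in>W n. f w = 0"
  shows "\<exists>n. W n \<subseteq> S"
proof (rule ccontr)
  assume "\<nexists>n. W n \<subseteq> S"
  then have ex: "\<exists>w. w \<in> W n \<and> w \<notin> S" for n by blast
  define V where "V n = {w + s | w s. w \<in> W n \<and> s \<in> S}" for n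
  have antiW: "W n \<subseteq> W m" if "m \<le> n" for m n
    using lift_Suc_antimono_le[of W, OF W(2) that] .
  have antiV: "V n \<subseteq> V m" if "m \<le> n" for m n
    using antiW[OF that] unfolding V_def by blast
  have subV: "subspace (V n)" for n
    unfolding V_def by (rule subspace_sums[OF W(1) S])
  have WV: "W n \<subseteq> V n" for n
    unfolding V_def using subspace_0[OF S] by force
  have SV: "S \<subseteq> V n" for n
    unfolding V_def using subspace_0[OF W(1)] by force
  \<comment> \<open>Otherwise \<open>v\<close> is in all \<open>V m\<close>, and a functional with value 1 at \<open>v\<close> that vanishes on \<open>S\<close> is
    not zero on any \<open>W m\<close>.\<close>
  have leave: "\<exists>m>n. v \<notin> V m" if v: "v \<notin> S" for v n
  proof -
    obtain f where f: "f \<in> dual scale" "\<forall>s\<in>S. f s = 0" "f v = 1"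
      using dual_separates[OF S v] by blast
    then obtain m where m: "\<forall>w\<in>W m. f w = 0" using kill by blast
    interpret f: Vector_Spaces.linear scale "(*)" f using f by (simp add: dual_def)
    have "v \<notin> V m" using m f(2,3) by (auto simp: V_def f.add)
    then have "v \<notin> V (max m (Suc n))" using antiV[of m "max m (Suc n)"] by auto
    then show ?thesis by (intro exI[of _ "max m (Suc n)"]) auto
  qed
  obtain pick where pick: "\<And>n. pick n \<in> W n" "\<And>n. pick n \<notin> S" using ex by metis
  have "\<exists>m>n. pick n \<notin> V m" for n using leave[OF pick(2)] .
  then obtain nxt where nxt: "\<And>n. nxt n > n" "\<And>n. pick n \<notin> V (nxt n)" by metis
  \<comment> \<open>A subsequence of the chain and vectors \<open>w k\<close> in it, each outside the sum of \<open>S\<close> and the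
    next member.\<close>
  define N where "N k = (nxt ^^ k) 0" for k
  have NSuc: "N (Suc k) = nxt (N k)" for k by (simp add: N_def)
  have Nmono: "strict_mono N" by (simp add: strict_mono_Suc_iff NSuc nxt(1))
  define w where "w k = pick (N k)" for k
  have w: "w k \<in> W (N k)" "w k \<notin> V (N (Suc k))" for k
    by (simp_all add: w_def pick(1) NSuc nxt(2))
  obtain B where B: "B \<subseteq> S" "independent B" "span B = S"
    using S basis_exists[of S] span_minimal[OF _ S] by (metis subset_antisym)
  \<comment> \<open>Vectors are added in order of decreasing index, since those of index above \<open>j\<close> stay in
    \<open>V (N (Suc j))\<close>, which omits \<open>w j\<close>.\<close>
  have fin: "independent (B \<union> w ` {j..<j+d})" for d j
  proof (induct d arbitrary: j)
    case 0 show ?case using B(2) by simp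
  next
    case (Suc d)
    have eq: "B \<union> w ` {j..<j + Suc d} = insert (w j) (B \<union> w ` {Suc j..<Suc j + d})"
      by (auto simp: image_iff) (metis atLeastLessThan_iff Suc_leI le_neq_implies_less)
    have "B \<union> w ` {Suc j..<Suc j + d} \<subseteq> V (N (Suc j))"
    proof -
      have "w i \<in> V (N (Suc j))" if "Suc j \<le> i" for i
        using w(1)[of i] WV antiV[of "N (Suc j)" "N i"] strict_mono_leD[OF Nmono that] by blast
      then show ?thesis using B(1) SV by auto
    qed
    then have "w j \<notin> span (B \<union> w ` {Suc j..<Suc j + d})"
      using span_minimal[OF _ subV] w(2)[of j] by blast
    then show ?case unfolding eq by (rule independent_insertI[OF _ Suc])
  qed
  have ind: "independent (B \<union> range w)"
  proof -
    have "independent (\<Union>d. B \<union> w ` {0..<0+d})"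
    proof (rule independent_Union_directed)
      fix c d assume "c \<in> range (\<lambda>d. B \<union> w ` {0..<0+d})" "d \<in> range (\<lambda>d. B \<union> w ` {0..<0+d})"
      then obtain m n where mn: "c = B \<union> w ` {0..<m}" "d = B \<union> w ` {0..<n}" by auto
      show "c \<subseteq> d \<or> d \<subseteq> c"
        unfolding mn by (cases "m \<le> n") (auto intro!: imageI)
    next
      fix c assume "c \<in> range (\<lambda>d. B \<union> w ` {0..<0+d})"
      then show "independent c" using fin[of 0] by blast
    qed
    moreover have "w i \<in> (\<Union>d. B \<union> w ` {0..<0+d})" for i
      by (rule UN_I[of "Suc i"]) auto
    then have "(\<Union>d. B \<union> w ` {0..<0+d}) = B \<union> range w" by blast
    ultimately show ?thesis by simp
  qed
  obtain f where f: "f \<in> dual scale" "\<forall>b\<in>B \<union> range w. f b = (if b \<in> B then 0 else 1)"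
    using dual_independent_extend[OF ind, of "\<lambda>b. if b \<in> B then 0 else 1"] by blast
  have fS: "\<forall>s\<in>S. f s = 0"
    using dual_zero_on_span[OF f(1), of B] f(2) B(3) by auto
  have "w k \<notin> S" for k by (simp add: w_def pick(2))
  then have fw: "f (w k) = 1" for k using f(2) B(1) by auto
  obtain n where n: "\<forall>v\<in>W n. f v = 0" using kill[OF f(1) fS] by blast
  have "n \<le> N n" using strict_mono_imp_increasing[OF Nmono] .
  then show False using n fw[of n] w(1)[of n] antiW by force
qed

end

section \<open>The two actions of the dual of a coalgebra\<close>

lemma (in vector_space) dual_iff:
  "f \<in> dual scale \<longleftrightarrow> (\<forall>x y. f (x + y) = f x + f y) \<and> (\<forall>k x. f (scale k x) = k * f x)"
  unfolding dual_def mem_Collect_eq linear_iff_module_hom module_hom_iff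
  by (auto simp: module_axioms) (unfold_locales, auto simp: algebra_simps)

context coalgebra
begin

abbreviation left_action (infixr "\<rhd>" 75) where "f \<rhd> x \<equiv> lact scale \<Delta> f x"

abbreviation right_action (infixl "\<lhd>" 75) where "x \<lhd> g \<equiv> ract scale \<Delta> g x"

text \<open>
  The product of the dual algebra: \<open>f \<star> g\<close> sends \<open>c\<close> to \<open>\<Sum> f(c\<^sub>1) g(c\<^sub>2)\<close>. On the dual it makes
  the action multiplicative, by coassociativity.
\<close>

definition conv :: "('c \<Rightarrow> 'k) \<Rightarrow> ('c \<Rightarrow> 'k) \<Rightarrow> 'c \<Rightarrow> 'k" (infixl "\<star>" 80)
  where "f \<star> g = (\<lambda>c. f (g \<rhd> c))"

lemma counit_dual: "\<epsilon> \<in> dual scale"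
  using counit_linear by (simp add: dual_def)

lemma dual_diff: "f \<in> dual scale \<Longrightarrow> f (x - y) = f x - f y"
  unfolding dual_def mem_Collect_eq
  by (rule module_hom.diff[OF iffD1[OF linear_iff_module_hom]])

lemma dual_0: "f \<in> dual scale \<Longrightarrow> f 0 = 0"
  using dual_diff[of f 0 0] by simp

lemma dual_zero_mem: "(\<lambda>_. 0) \<in> dual scale"
  and dual_add_mem: "f \<in> dual scale \<Longrightarrow> g \<in> dual scale \<Longrightarrow> (\<lambda>c. f c + g c) \<in> dual scale"
  and dual_diff_mem: "f \<in> dual scale \<Longrightarrow> g \<in> dual scale \<Longrightarrow> (\<lambda>c. f c - g c) \<in> dual scale"
  and dual_scale_mem: "f \<in> dual scale \<Longrightarrow> (\<lambda>c. k * f c) \<in> dual scale"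
  by (auto simp: dual_iff algebra_simps)

lemma dual_lin_ext:
  "f \<in> dual scale \<Longrightarrow> f (lin_ext scale \<phi> p) = lin_ext (*) (\<lambda>x. f (\<phi> x)) p"
  unfolding dual_def mem_Collect_eq by (rule linear_image_lin_ext)

lemma lact_add: "f \<in> dual scale \<Longrightarrow> f \<rhd> (x + y) = f \<rhd> x + f \<rhd> y"
proof -
  assume f: "f \<in> dual scale"
  obtain p q where "p \<in> \<Delta> x" "q \<in> \<Delta> y" using comult_nonempty by blast
  then show ?thesis
    using lact_eq[OF f, of p x] lact_eq[OF f, of q y] lact_eq[OF f comult_add, of p x q y]
    by (simp add: module_hom.add[OF iffD1[OF linear_iff_module_hom linear_lin_ext]])
qed

lemma lact_scale: "f \<in> dual scale \<Longrightarrow> f \<rhd> scale k x = scale k (f \<rhd> x)"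
proof -
  assume f: "f \<in> dual scale"
  obtain p where "p \<in> \<Delta> x" using comult_nonempty by blast
  then show ?thesis
    using lact_eq[OF f, of p x] lact_eq[OF f comult_scale, of p x k]
    by (simp add: module_hom.scale[OF iffD1[OF linear_iff_module_hom linear_lin_ext]])
qed

lemma ract_add: "f \<in> dual scale \<Longrightarrow> (x + y) \<lhd> f = x \<lhd> f + y \<lhd> f"
proof -
  assume f: "f \<in> dual scale"
  obtain p q where "p \<in> \<Delta> x" "q \<in> \<Delta> y" using comult_nonempty by blast
  then show ?thesis
    using ract_eq[OF f, of p x] ract_eq[OF f, of q y] ract_eq[OF f comult_add, of p x q y]
    by (simp add: module_hom.add[OF iffD1[OF linear_iff_module_hom linear_lin_ext]])
qed

lemma ract_scale: "f \<in> dual scale \<Longrightarrow> scale k x \<lhd> f = scale k (x \<lhd> f)"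
proof -
  assume f: "f \<in> dual scale"
  obtain p where "p \<in> \<Delta> x" using comult_nonempty by blast
  then show ?thesis
    using ract_eq[OF f, of p x] ract_eq[OF f comult_scale, of p x k]
    by (simp add: module_hom.scale[OF iffD1[OF linear_iff_module_hom linear_lin_ext]])
qed

lemma lact_zero: "f \<in> dual scale \<Longrightarrow> f \<rhd> 0 = 0"
  using lact_add[of f 0 0] by simp

lemma lact_diff: "f \<in> dual scale \<Longrightarrow> f \<rhd> (x - y) = f \<rhd> x - f \<rhd> y"
  using lact_add[of f "x - y" y] by simp

lemma ract_zero: "f \<in> dual scale \<Longrightarrow> 0 \<lhd> f = 0"
  using ract_add[of f 0 0] by simp

lemma add_lact:
  assumes "f \<in> dual scale" "g \<in> dual scale"
  shows "(\<lambda>c. f c + g c) \<rhd> x = f \<rhd> x + g \<rhd> x"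
proof -
  obtain p where p: "p \<in> \<Delta> x" using comult_nonempty by blast
  show ?thesis
    unfolding lact_eq[OF assms(1) p] lact_eq[OF assms(2) p] lact_eq[OF dual_add_mem[OF assms] p]
    by (simp add: lin_ext_def case_prod_unfold sum.distrib algebra_simps)
qed

lemma scale_lact:
  assumes "f \<in> dual scale"
  shows "(\<lambda>c. k * f c) \<rhd> x = scale k (f \<rhd> x)"
proof -
  obtain p where p: "p \<in> \<Delta> x" using comult_nonempty by blast
  show ?thesis
    unfolding lact_eq[OF assms p] lact_eq[OF dual_scale_mem[OF assms] p]
    by (simp add: lin_ext_def case_prod_unfold scale_sum_right algebra_simps)
qed

lemma diff_lact:
  assumes "f \<in> dual scale" "g \<in> dual scale"
  shows "(\<lambda>c. f c - g c) \<rhd> x = f \<rhd> x - g \<rhd> x"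
  using add_lact[OF dual_diff_mem[OF assms] assms(2), of x] by simp

lemma counit_lact: "\<epsilon> \<rhd> x = x"
proof -
  obtain p where p: "p \<in> \<Delta> x" using comult_nonempty by blast
  show ?thesis unfolding lact_eq[OF counit_dual p] using counit_right[OF p] .
qed

lemma ract_counit: "x \<lhd> \<epsilon> = x"
proof -
  obtain p where p: "p \<in> \<Delta> x" using comult_nonempty by blast
  show ?thesis unfolding ract_eq[OF counit_dual p] using counit_left[OF p] .
qed

text \<open>
  Both sides are \<open>\<Sum> h(x\<^sub>1) f(x\<^sub>2)\<close>. This adjointness turns conditions on the elements \<open>f \<cdot> x\<close> into
  conditions that \<open>f\<close> vanishes on some vectors.
\<close>

lemma pairing_lact_ract:
  assumes "f \<in> dual scale" "h \<in> dual scale"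
  shows "h (f \<rhd> x) = f (x \<lhd> h)"
proof -
  obtain p where p: "p \<in> \<Delta> x" using comult_nonempty by blast
  have "h (f \<rhd> x) = lin_ext (*) (\<lambda>(a, b). f b * h a) p"
    using assms by (simp add: lact_eq[OF _ p] dual_lin_ext case_prod_unfold dual_iff)
  also have "\<dots> = f (x \<lhd> h)"
    using assms by (simp add: ract_eq[OF _ p] dual_lin_ext case_prod_unfold dual_iff mult.commute)
  finally show ?thesis .
qed

text \<open>
  Coassociativity in the only form in which it is used below, with \<open>\<phi>\<close> a trilinear map applied
  to \<open>\<Sum> x\<^sub>1 \<otimes> x\<^sub>2 \<otimes> x\<^sub>3\<close>.
\<close>

lemma coassoc_trilinear:
  assumes "\<And>a a' b c. \<phi> (a + a', b, c) = \<phi> (a, b, c) + \<phi> (a', b, c)"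
    and "\<And>a b b' c. \<phi> (a, b + b', c) = \<phi> (a, b, c) + \<phi> (a, b', c)"
    and "\<And>a b c c'. \<phi> (a, b, c + c') = \<phi> (a, b, c) + \<phi> (a, b, c')"
    and "\<And>k a b c. \<phi> (scale k a, b, c) = scale k (\<phi> (a, b, c))"
    and "\<And>k a b c. \<phi> (a, scale k b, c) = scale k (\<phi> (a, b, c))"
    and "\<And>k a b c. \<phi> (a, b, scale k c) = scale k (\<phi> (a, b, c))"
    and p: "p \<in> \<Delta> x" and r: "\<And>y. r y \<in> \<Delta> y"
  shows "lin_ext scale (\<lambda>(a, b). lin_ext scale (\<lambda>(y, z). \<phi> (y, z, b)) (r a)) p =
    lin_ext scale (\<lambda>(a, b). lin_ext scale (\<lambda>(y, z). \<phi> (a, y, z)) (r b)) p"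
proof -
  interpret L: Vector_Spaces.linear fscale scale "lin_ext scale \<phi>" by (rule linear_lin_ext)
  have "lin_ext scale \<phi>
      (lin_ext fscale (\<lambda>(a, b). lin_ext fscale (\<lambda>(y, z). Poly_Mapping.single (y, z, b) 1) (r a)) p
      - lin_ext fscale (\<lambda>(a, b). lin_ext fscale (\<lambda>(y, z). Poly_Mapping.single (a, y, z) 1) (r b)) p) = 0"
    by (rule lin_ext_tensor3_null[OF assms(1-6) coassoc[OF p r]])
  then show ?thesis
    by (simp add: L.diff lin_ext_lin_ext_fscale case_prod_unfold lin_ext_single)
qed

lemma conv_dual: "f \<in> dual scale \<Longrightarrow> g \<in> dual scale \<Longrightarrow> f \<star> g \<in> dual scale"
  unfolding dual_iff[of "f \<star> g"] by (simp add: conv_def lact_add lact_scale) (simp add: dual_iff)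

lemma conv_lact:
  assumes f: "f \<in> dual scale" and g: "g \<in> dual scale"
  shows "(f \<star> g) \<rhd> x = f \<rhd> g \<rhd> x"
proof -
  obtain r where r: "\<And>y. r y \<in> \<Delta> y" using comult_nonempty by metis
  define \<phi> where "\<phi> = (\<lambda>(a, b, c). scale (f b * g c) a)"
  have conv_eq: "(f \<star> g) b = lin_ext (*) (\<lambda>(y, z). g z * f y) (r b)" for b
    using f by (simp add: conv_def lact_eq[OF g r] dual_lin_ext[OF f] case_prod_unfold dual_iff)
  have "f \<rhd> g \<rhd> x = lin_ext scale (\<lambda>(a, b). scale (g b) (f \<rhd> a)) (r x)"
    unfolding lact_eq[OF g r[of x]] using lact_add[OF f] lact_scale[OF f]
    by (subst linear_image_lin_ext[where scale' = scale])
      (auto simp: linear_iff_module_hom module_hom_iff module_axioms vector_space_axioms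
        case_prod_unfold)
  also have "\<dots> = lin_ext scale (\<lambda>(a, b). lin_ext scale (\<lambda>(y, z). \<phi> (y, z, b)) (r a)) (r x)"
    by (simp add: lact_eq[OF f r] \<phi>_def lin_ext_def
        case_prod_unfold scale_sum_right mult.commute mult.left_commute)
  also have "\<dots> = lin_ext scale (\<lambda>(a, b). lin_ext scale (\<lambda>(y, z). \<phi> (a, y, z)) (r b)) (r x)"
    by (rule coassoc_trilinear[OF _ _ _ _ _ _ r r])
      (use f g in \<open>auto simp: \<phi>_def dual_iff algebra_simps\<close>)
  also have "\<dots> = lin_ext scale (\<lambda>(a, b). scale ((f \<star> g) b) a) (r x)"
    by (simp add: conv_eq \<phi>_def lin_ext_def case_prod_unfold scale_sum_left sum_distrib_right
        mult.commute mult.left_commute)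
  finally show ?thesis by (simp add: lact_eq[OF conv_dual[OF f g] r])
qed

lemma lact_ract_commute:
  assumes f: "f \<in> dual scale" and g: "g \<in> dual scale"
  shows "(f \<rhd> x) \<lhd> g = f \<rhd> (x \<lhd> g)"
proof -
  obtain r where r: "\<And>y. r y \<in> \<Delta> y" using comult_nonempty by metis
  define \<phi> where "\<phi> = (\<lambda>(a, b, c). scale (g a * f c) b)"
  have "(f \<rhd> x) \<lhd> g = lin_ext scale (\<lambda>(a, b). scale (f b) (a \<lhd> g)) (r x)"
    unfolding lact_eq[OF f r[of x]] using ract_add[OF g] ract_scale[OF g]
    by (subst linear_image_lin_ext[where scale' = scale and g = "ract scale \<Delta> g"])
      (auto simp: linear_iff_module_hom module_hom_iff module_axioms vector_space_axioms
        case_prod_unfold)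
  also have "\<dots> = lin_ext scale (\<lambda>(a, b). lin_ext scale (\<lambda>(y, z). \<phi> (y, z, b)) (r a)) (r x)"
    by (simp add: ract_eq[OF g r] \<phi>_def lin_ext_def
        case_prod_unfold scale_sum_right mult.commute mult.left_commute)
  also have "\<dots> = lin_ext scale (\<lambda>(a, b). lin_ext scale (\<lambda>(y, z). \<phi> (a, y, z)) (r b)) (r x)"
    by (rule coassoc_trilinear[OF _ _ _ _ _ _ r r])
      (use f g in \<open>auto simp: \<phi>_def dual_iff algebra_simps\<close>)
  also have "\<dots> = lin_ext scale (\<lambda>(a, b). scale (g a) (f \<rhd> b)) (r x)"
    by (simp add: lact_eq[OF f r] \<phi>_def lin_ext_def
        case_prod_unfold scale_sum_right mult.commute mult.left_commute)
  also have "\<dots> = f \<rhd> (x \<lhd> g)"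
    unfolding ract_eq[OF g r[of x]] using lact_add[OF f] lact_scale[OF f]
    by (subst linear_image_lin_ext[where scale' = scale and g = "lact scale \<Delta> f"])
      (auto simp: linear_iff_module_hom module_hom_iff module_axioms vector_space_axioms
        case_prod_unfold)
  finally show ?thesis .
qed

text \<open>
  Local finiteness: one formal sum \<open>\<Sum> a\<^sub>i \<otimes> b\<^sub>i\<close> for the comultiplication of \<open>x\<close> confines all
  \<open>f \<cdot> x\<close> to the span of the \<open>a\<^sub>i\<close>.
\<close>

lemma finite_dim_lact_orbit:
  "\<exists>B. finite B \<and> (\<forall>f\<in>dual scale. f \<rhd> x \<in> span B)"
proof -
  obtain p where p: "p \<in> \<Delta> x" using comult_nonempty by blast
  have "f \<rhd> x \<in> span (fst ` Poly_Mapping.keys p)" if "f \<in> dual scale" for f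
    unfolding lact_eq[OF that p] lin_ext_def
    by (auto simp: case_prod_unfold simp del: scale_scale intro!: span_sum span_scale intro: span_base)
  then show ?thesis by (intro exI[of _ "fst ` Poly_Mapping.keys p"]) simp
qed

lemma finite_dim_ract_orbit:
  "\<exists>B. finite B \<and> (\<forall>f\<in>dual scale. x \<lhd> f \<in> span B)"
proof -
  obtain p where p: "p \<in> \<Delta> x" using comult_nonempty by blast
  have "x \<lhd> f \<in> span (snd ` Poly_Mapping.keys p)" if "f \<in> dual scale" for f
    unfolding ract_eq[OF that p] lin_ext_def
    by (auto simp: case_prod_unfold simp del: scale_scale intro!: span_sum span_scale intro: span_base)
  then show ?thesis by (intro exI[of _ "snd ` Poly_Mapping.keys p"]) simp
qed

text \<open>
  The annihilator of \<open>x\<close> is open in the finite topology: it contains the functionals vanishing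
  on the right tensor factors \<open>b\<^sub>i\<close>.
\<close>

lemma lact_zero_if_zero_on_finite:
  "\<exists>B. finite B \<and> (\<forall>f\<in>dual scale. (\<forall>b\<in>B. f b = 0) \<longrightarrow> f \<rhd> x = 0)"
proof -
  obtain p where p: "p \<in> \<Delta> x" using comult_nonempty by blast
  have "f \<rhd> x = 0" if "f \<in> dual scale" "\<forall>b\<in>snd ` Poly_Mapping.keys p. f b = 0" for f
    unfolding lact_eq[OF that(1) p] lin_ext_def
    by (intro sum.neutral) (use that(2) in \<open>auto simp: case_prod_unfold\<close>)
  then show ?thesis by (intro exI[of _ "snd ` Poly_Mapping.keys p"]) simp
qed

section \<open>Socles of quotients and covers of submodules\<close>

definition left_submod :: "'c set \<Rightarrow> bool"
  where "left_submod N \<longleftrightarrow> 0 \<in> N \<and> (\<forall>x\<in>N. \<forall>y\<in>N. x + y \<in> N) \<and>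
    (\<forall>f\<in>dual scale. \<forall>x\<in>N. f \<rhd> x \<in> N)"

text \<open>
  The lattice-theoretic form of ``\<open>S/L\<close> is simple''. No ambient module occurs in it, so that it
  can be used for all submodules of \<open>C\<close> at once.
\<close>

definition covers :: "'c set \<Rightarrow> 'c set \<Rightarrow> bool"
  where "covers S L \<longleftrightarrow> left_submod S \<and> L \<subset> S \<and>
    (\<forall>T. left_submod T \<and> L \<subseteq> T \<and> T \<subseteq> S \<longrightarrow> T = L \<or> T = S)"

text \<open>The preimage in \<open>D\<close> of the socle of \<open>D/L\<close>.\<close>

definition socle_over :: "'c set \<Rightarrow> 'c set \<Rightarrow> 'c set"
  where "socle_over L D = \<Inter>{N. left_submod N \<and> L \<subseteq> N \<and> N \<subseteq> D \<and>
    (\<forall>S. covers S L \<and> S \<subseteq> D \<longrightarrow> S \<subseteq> N)}"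

lemma submod_left_module: "submod (left_module scale \<Delta> D) N \<longleftrightarrow> left_submod N \<and> N \<subseteq> D"
  by (auto simp: submod_def left_module_def left_submod_def)

text \<open>Scalars act through the multiples of the counit.\<close>

lemma left_submod_scale:
  assumes "left_submod N" "x \<in> N"
  shows "scale k x \<in> N"
proof -
  have "(\<lambda>c. k * \<epsilon> c) \<rhd> x \<in> N"
    using assms dual_scale_mem[OF counit_dual] unfolding left_submod_def by blast
  then show ?thesis by (simp add: scale_lact counit_dual counit_lact)
qed

lemma left_submod_subspace: "left_submod N \<Longrightarrow> subspace N"
  using left_submod_scale by (auto simp: subspace_def left_submod_def)

lemma left_submodD:
  assumes "left_submod N"
  shows "0 \<in> N" "x \<in> N \<Longrightarrow> y \<in> N \<Longrightarrow> x + y \<in> N" "f \<in> dual scale \<Longrightarrow> x \<in> N \<Longrightarrow> f \<rhd> x \<in> N"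
    "x \<in> N \<Longrightarrow> y \<in> N \<Longrightarrow> x - y \<in> N"
  using assms subspace_diff[OF left_submod_subspace[OF assms]] by (simp_all add: left_submod_def)

lemma left_submod_zero: "left_submod {0}"
  by (simp add: left_submod_def lact_zero)

lemma socle_left_module: "socle (left_module scale \<Delta> D) = socle_over {0} D"
proof -
  have zero: "{0} \<subseteq> N" if "left_submod N" for N using that by (simp add: left_submod_def)
  have mz: "mzero (left_module scale \<Delta> D) = 0" by (simp add: left_module_def)
  have simple: "simple_submod (left_module scale \<Delta> D) S \<longleftrightarrow> covers S {0} \<and> S \<subseteq> D" for S
  proof
    assume "simple_submod (left_module scale \<Delta> D) S"
    then have S: "left_submod S" "S \<subseteq> D" "S \<noteq> {0}"
      "\<And>T. left_submod T \<Longrightarrow> T \<subseteq> D \<Longrightarrow> T \<subseteq> S \<Longrightarrow> T = {0} \<or> T = S"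
      unfolding simple_submod_def submod_left_module mz by simp_all
    have "T = {0} \<or> T = S" if "left_submod T" "T \<subseteq> S" for T
      using S(4)[OF that(1) subset_trans[OF that(2) S(2)] that(2)] .
    then show "covers S {0} \<and> S \<subseteq> D"
      unfolding covers_def psubset_eq using S(1-3) zero[OF S(1)] by simp
  next
    assume "covers S {0} \<and> S \<subseteq> D"
    then show "simple_submod (left_module scale \<Delta> D) S"
      unfolding simple_submod_def submod_left_module mz covers_def psubset_eq using zero by auto
  qed
  have "{N. (left_submod N \<and> N \<subseteq> D) \<and> (\<forall>S. covers S {0} \<and> S \<subseteq> D \<longrightarrow> S \<subseteq> N)} =
      {N. left_submod N \<and> {0} \<subseteq> N \<and> N \<subseteq> D \<and> (\<forall>S. covers S {0} \<and> S \<subseteq> D \<longrightarrow> S \<subseteq> N)}"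
    by (intro Collect_cong) (use zero in blast)
  then show ?thesis unfolding socle_def socle_over_def submod_left_module simple by simp
qed

text \<open>
  The correspondence theorem: submodules of \<open>D/L\<close> are the images of the submodules between \<open>L\<close>
  and \<open>D\<close>, and simple ones come from covers of \<open>L\<close>. It replaces sets of cosets by submodules of
  \<open>C\<close>.
\<close>

lemma socle_quot_module:
  assumes D: "left_submod D" and L: "left_submod L" and LD: "L \<subseteq> D" and x: "x \<in> D"
  shows "mcoset (left_module scale \<Delta> D) L x \<in> socle (quot_module (left_module scale \<Delta> D) L)
    \<longleftrightarrow> x \<in> socle_over L D"
proof -
  define M where "M = left_module scale \<Delta> D"
  define Q where "Q = quot_module M L"
  define coset where "coset x = mcoset M L x" for x
  note subL = left_submod_subspace[OF L]
  have coset: "coset x = {x + l | l. l \<in> L}" for x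
    by (simp add: coset_def mcoset_def M_def left_module_def)
  have mem_coset: "y \<in> coset x \<longleftrightarrow> y - x \<in> L" for x y
    unfolding coset by (auto intro!: exI[of _ "y - x"])
  have coset_eq: "coset x = coset y \<longleftrightarrow> x - y \<in> L" for x y
  proof
    assume "coset x = coset y"
    then show "x - y \<in> L" using mem_coset[of x x] mem_coset[of x y] subspace_0[OF subL] by simp
  next
    assume xy: "x - y \<in> L"
    have "z - x \<in> L \<longleftrightarrow> z - y \<in> L" for z
      using subspace_add[OF subL, of "z - x" "x - y"] subspace_diff[OF subL, of "z - y" "x - y"] xy
      by (auto simp: algebra_simps)
    then show "coset x = coset y" by (auto simp: mem_coset)
  qed
  have coset_0: "coset 0 = L" by (auto simp: mem_coset)
  have carrier: "mcarrier Q = coset ` D" "mzero Q = L" "mscalars Q = dual scale"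
    by (auto simp: Q_def quot_module_def coset_def M_def left_module_def)
  have madd: "madd Q (coset x) (coset y) = coset (x + y)" for x y
  proof -
    have "madd Q (coset x) (coset y) = {a + b | a b. a \<in> coset x \<and> b \<in> coset y}"
      by (simp add: Q_def quot_module_def M_def left_module_def)
    also have "\<dots> = coset (x + y)"
    proof (intro subset_antisym subsetI)
      fix z assume "z \<in> {a + b | a b. a \<in> coset x \<and> b \<in> coset y}"
      then obtain a b where "z = a + b" "a - x \<in> L" "b - y \<in> L" by (auto simp: mem_coset)
      then show "z \<in> coset (x + y)"
        using subspace_add[OF subL, of "a - x" "b - y"] by (simp add: mem_coset algebra_simps)
    next
      fix z assume "z \<in> coset (x + y)"
      then have "z = (z - y) + y" "z - y \<in> coset x" "y \<in> coset y"
        using subspace_0[OF subL] by (auto simp: mem_coset algebra_simps)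
      then show "z \<in> {a + b | a b. a \<in> coset x \<and> b \<in> coset y}" by blast
    qed
    finally show ?thesis .
  qed
  have mact: "mact Q f (coset x) = coset (f \<rhd> x)" if f: "f \<in> dual scale" for f x
  proof -
    have "mact Q f (coset x) = {(f \<rhd> a) + l | a l. a \<in> coset x \<and> l \<in> L}"
      by (simp add: Q_def quot_module_def M_def left_module_def)
    also have "\<dots> = coset (f \<rhd> x)"
    proof (intro subset_antisym subsetI)
      fix z assume "z \<in> {(f \<rhd> a) + l | a l. a \<in> coset x \<and> l \<in> L}"
      then obtain a l where z: "z = (f \<rhd> a) + l" "a - x \<in> L" "l \<in> L" by (auto simp: mem_coset)
      have "f \<rhd> (a - x) \<in> L" using L f z(2) by (simp add: left_submod_def)
      then show "z \<in> coset (f \<rhd> x)"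
        using subspace_add[OF subL _ z(3), of "f \<rhd> (a - x)"] z(1)
        by (simp add: mem_coset lact_diff f diff_add_eq)
    next
      fix z assume "z \<in> coset (f \<rhd> x)"
      then have "z = (f \<rhd> x) + (z - (f \<rhd> x))" "z - (f \<rhd> x) \<in> L" "x \<in> coset x"
        using subspace_0[OF subL] by (auto simp: mem_coset)
      then show "z \<in> {(f \<rhd> a) + l | a l. a \<in> coset x \<and> l \<in> L}" by blast
    qed
    finally show ?thesis .
  qed
  \<comment> \<open>The submodules that have an image in the quotient.\<close>
  define over where "over N \<longleftrightarrow> left_submod N \<and> L \<subseteq> N \<and> N \<subseteq> D" for N
  have mem_image: "coset x \<in> coset ` N \<longleftrightarrow> x \<in> N" if "over N" for x N
  proof
    assume "coset x \<in> coset ` N"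
    then obtain y where y: "y \<in> N" "x - y \<in> L" by (auto simp: coset_eq)
    then have "y + (x - y) \<in> N" using that unfolding over_def left_submod_def by blast
    then show "x \<in> N" by simp
  qed simp
  have image_subset: "coset ` N \<subseteq> coset ` N' \<longleftrightarrow> N \<subseteq> N'" if "over N'" for N N'
    using mem_image[OF that] by blast
  have image_inj: "coset ` N = coset ` N' \<longleftrightarrow> N = N'" if "over N" "over N'" for N N'
    using image_subset[OF that(1), of N'] image_subset[OF that(2), of N] by (simp only: set_eq_subset)
  have submod_image: "submod Q (coset ` N)" if "over N" for N
    unfolding submod_def
  proof (intro conjI ballI)
    show "coset ` N \<subseteq> mcarrier Q" using that carrier(1) by (auto simp: over_def)
    show "mzero Q \<in> coset ` N" unfolding carrier coset_0[symmetric]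
      using that by (auto simp: over_def left_submod_def)
    show "madd Q a b \<in> coset ` N" if "a \<in> coset ` N" "b \<in> coset ` N" for a b
      using that \<open>over N\<close> by (auto simp: madd over_def left_submod_def)
    show "mact Q f a \<in> coset ` N" if "a \<in> coset ` N" "f \<in> mscalars Q" for f a
      using that \<open>over N\<close> by (auto simp: carrier mact over_def left_submod_def)
  qed
  have submod_is_image: "\<exists>N'. over N' \<and> N = coset ` N'" if N: "submod Q N" for N
  proof -
    let ?N' = "{x \<in> D. coset x \<in> N}"
    have LN: "L \<in> N" using N carrier by (simp add: submod_def)
    have "over ?N'"
      unfolding over_def left_submod_def
    proof (intro conjI ballI)
      show "L \<subseteq> ?N'"
      proof
        fix l assume "l \<in> L"
        then have "coset l = L" using coset_eq[of l 0] coset_0 by simp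
        then show "l \<in> ?N'" using \<open>l \<in> L\<close> LD LN by auto
      qed
      then show "0 \<in> ?N'" using subspace_0[OF subL] by blast
      show "x + y \<in> ?N'" if "x \<in> ?N'" "y \<in> ?N'" for x y
      proof -
        have "madd Q (coset x) (coset y) \<in> N" using that N by (simp add: submod_def)
        then show ?thesis using that D by (simp add: madd left_submod_def)
      qed
      show "f \<rhd> x \<in> ?N'" if "f \<in> dual scale" "x \<in> ?N'" for f x
      proof -
        have "mact Q f (coset x) \<in> N" using that N carrier(3) by (simp add: submod_def)
        then show ?thesis using that D by (simp add: mact left_submod_def)
      qed
    qed auto
    moreover have "N = coset ` ?N'" using N carrier by (auto simp: submod_def)
    ultimately show ?thesis by blast
  qed
  have overL: "over L" using L LD by (simp add: over_def)
  have zero: "{mzero Q} = coset ` L"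
  proof -
    have "coset l = L" if "l \<in> L" for l using that coset_eq[of l 0] coset_0 by simp
    then show ?thesis using carrier subspace_0[OF subL] by auto
  qed
  have simple: "simple_submod Q (coset ` S) \<longleftrightarrow> covers S L" if S: "over S" for S
  proof -
    have "simple_submod Q (coset ` S) \<longleftrightarrow> coset ` S \<noteq> coset ` L \<and>
        (\<forall>T. submod Q T \<and> T \<subseteq> coset ` S \<longrightarrow> T = coset ` L \<or> T = coset ` S)"
      unfolding simple_submod_def zero using submod_image[OF S] by simp
    also have "\<dots> \<longleftrightarrow> coset ` S \<noteq> coset ` L \<and>
        (\<forall>T. over T \<and> coset ` T \<subseteq> coset ` S \<longrightarrow> coset ` T = coset ` L \<or> coset ` T = coset ` S)"
      (is "_ \<and> ?A \<longleftrightarrow> _ \<and> ?B")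
    proof (rule arg_cong2[where f = "(\<and>)", OF refl], rule iffI)
      show ?B if ?A using that submod_image by simp
      show ?A if B: ?B
      proof (intro allI impI, elim conjE)
        fix T assume T: "submod Q T" "T \<subseteq> coset ` S"
        obtain T' where T': "over T'" "T = coset ` T'" using submod_is_image[OF T(1)] by blast
        show "T = coset ` L \<or> T = coset ` S"
          using B[rule_format, of T'] T(2) T' by simp
      qed
    qed
    also have "\<dots> \<longleftrightarrow> S \<noteq> L \<and> (\<forall>T. over T \<and> T \<subseteq> S \<longrightarrow> T = L \<or> T = S)"
      using S overL by (simp add: image_subset image_inj cong: conj_cong imp_cong)
    also have "\<dots> \<longleftrightarrow> covers S L"
    proof -
      have "over T \<and> T \<subseteq> S \<longleftrightarrow> left_submod T \<and> L \<subseteq> T \<and> T \<subseteq> S" for T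
        using S by (auto simp: over_def)
      then show ?thesis using S by (auto simp: covers_def psubset_eq over_def)
    qed
    finally show ?thesis .
  qed
  have "coset x \<in> socle Q \<longleftrightarrow>
      (\<forall>N. over N \<and> (\<forall>S. over S \<and> covers S L \<longrightarrow> S \<subseteq> N) \<longrightarrow> x \<in> N)" (is "_ \<longleftrightarrow> ?R")
  proof
    assume l: "coset x \<in> socle Q"
    show ?R
    proof (intro allI impI, elim conjE)
      fix N assume N: "over N" "\<forall>S. over S \<and> covers S L \<longrightarrow> S \<subseteq> N"
      have "S \<subseteq> coset ` N" if "simple_submod Q S" for S
      proof -
        have "submod Q S" using that by (simp add: simple_submod_def)
        then obtain S' where S': "over S'" "S = coset ` S'" using submod_is_image by blast
        then show ?thesis using N(2) simple[OF S'(1)] that by (simp add: image_mono)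
      qed
      then have "coset x \<in> coset ` N" using l submod_image[OF N(1)] unfolding socle_def by blast
      then show "x \<in> N" using mem_image[OF N(1)] by blast
    qed
  next
    assume r: ?R
    show "coset x \<in> socle Q"
      unfolding socle_def
    proof (intro InterI, clarify)
      fix N assume N: "submod Q N" "\<forall>S. simple_submod Q S \<longrightarrow> S \<subseteq> N"
      obtain N' where N': "over N'" "N = coset ` N'" using submod_is_image[OF N(1)] by blast
      have "S \<subseteq> N'" if "over S" "covers S L" for S
        using N(2)[rule_format, of "coset ` S"] simple[OF that(1)] that(2) N'(2)
          image_subset[OF N'(1), of S] by simp
      then have "x \<in> N'" using r N'(1) by simp
      then show "coset x \<in> N" using N'(2) by simp
    qed
  qed
  moreover have "over S \<and> covers S L \<longleftrightarrow> covers S L \<and> S \<subseteq> D" for S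
    by (auto simp: over_def covers_def)
  ultimately show ?thesis
    unfolding socle_over_def over_def[symmetric] coset_def Q_def M_def
    by (auto simp: over_def)
qed

section \<open>The socle in terms of left ideals\<close>

lemma conv_assoc: "f \<in> dual scale \<Longrightarrow> g \<in> dual scale \<Longrightarrow> h \<in> dual scale \<Longrightarrow> f \<star> g \<star> h = f \<star> (g \<star> h)"
  by (simp add: conv_def) (simp add: conv_lact[unfolded conv_def])

lemma counit_conv: "f \<in> dual scale \<Longrightarrow> \<epsilon> \<star> f = f"
  by (simp add: conv_def pairing_lact_ract[OF _ counit_dual] ract_counit)

definition left_ideal :: "('c \<Rightarrow> 'k) set \<Rightarrow> bool"
  where "left_ideal I \<longleftrightarrow> I \<subseteq> dual scale \<and> (\<lambda>_. 0) \<in> I \<and>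
    (\<forall>f\<in>I. \<forall>g\<in>I. (\<lambda>c. f c + g c) \<in> I) \<and> (\<forall>f\<in>dual scale. \<forall>g\<in>I. f \<star> g \<in> I)"

text \<open>
  In the quotient by \<open>I\<close> every nonzero element generates the class of the counit, the unit of
  the algebra. Maximal left ideals have this property, and so has the whole dual, which is
  admitted because it occurs as a colon ideal and as the annihilator of a zero vector.
\<close>

definition maximal_or_unit :: "('c \<Rightarrow> 'k) set \<Rightarrow> bool"
  where "maximal_or_unit I \<longleftrightarrow> left_ideal I \<and>
    (\<forall>f\<in>dual scale - I. \<exists>u\<in>dual scale. (\<lambda>c. (u \<star> f) c - \<epsilon> c) \<in> I)"

definition ann_mod :: "'c set \<Rightarrow> 'c \<Rightarrow> ('c \<Rightarrow> 'k) set"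
  where "ann_mod L x = {f \<in> dual scale. f \<rhd> x \<in> L}"

text \<open>
  For a left ideal \<open>K\<close> of the dual algebra \<open>A\<close>, this says that \<open>A/K\<close> is semisimple of finite
  length: it is then a quotient of a submodule of a finite product of simple modules \<open>A/I\<close>. The
  restriction to the dual matters for empty \<open>F\<close>, which stands for the unit ideal.
\<close>

definition semisimple_quotient :: "('c \<Rightarrow> 'k) set \<Rightarrow> bool"
  where "semisimple_quotient K \<longleftrightarrow> (\<exists>F. finite F \<and> (\<forall>I\<in>F. maximal_or_unit I) \<and>
    {f \<in> dual scale. \<forall>I\<in>F. f \<in> I} \<subseteq> K)"

lemma left_idealD:
  assumes "left_ideal I"
  shows "f \<in> I \<Longrightarrow> f \<in> dual scale"
    and "f \<in> I \<Longrightarrow> g \<in> I \<Longrightarrow> (\<lambda>c. f c + g c) \<in> I"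
    and "f \<in> dual scale \<Longrightarrow> g \<in> I \<Longrightarrow> f \<star> g \<in> I"
  using assms by (auto simp: left_ideal_def)

lemma maximal_or_unit_inverse:
  assumes "maximal_or_unit I" "f \<in> dual scale" "f \<notin> I"
  obtains u where "u \<in> dual scale" "(\<lambda>c. (u \<star> f) c - \<epsilon> c) \<in> I"
  using assms by (auto simp: maximal_or_unit_def)

lemma left_ideal_diff:
  assumes "left_ideal I" "f \<in> I" "g \<in> I"
  shows "(\<lambda>c. f c - g c) \<in> I"
proof -
  have "(\<lambda>c. - 1 * \<epsilon> c) \<star> g \<in> I"
    by (rule left_idealD(3)[OF assms(1) dual_scale_mem[OF counit_dual] assms(3)])
  moreover have "(\<lambda>c. - 1 * \<epsilon> c) \<star> g = (\<lambda>c. - (\<epsilon> \<star> g) c)" by (simp add: conv_def)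
  ultimately have "(\<lambda>c. - g c) \<in> I"
    using counit_conv[OF left_idealD(1)[OF assms(1,3)]] by simp
  then show ?thesis using left_idealD(2)[OF assms(1,2), of "\<lambda>c. - g c"] by simp
qed

lemma semisimple_quotientI:
  assumes "finite F" "\<And>I. I \<in> F \<Longrightarrow> maximal_or_unit I"
    and "\<And>f. f \<in> dual scale \<Longrightarrow> \<forall>I\<in>F. f \<in> I \<Longrightarrow> f \<in> K"
  shows "semisimple_quotient K"
  unfolding semisimple_quotient_def
  by (rule exI[of _ F]) (use assms in \<open>simp add: subset_eq\<close>)

lemma semisimple_quotientE:
  assumes "semisimple_quotient K"
  obtains F where "finite F" "\<forall>I\<in>F. maximal_or_unit I"
    "\<forall>f\<in>dual scale. (\<forall>I\<in>F. f \<in> I) \<longrightarrow> f \<in> K"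
proof -
  obtain F where "finite F \<and> (\<forall>I\<in>F. maximal_or_unit I) \<and> {f \<in> dual scale. \<forall>I\<in>F. f \<in> I} \<subseteq> K"
    using assms unfolding semisimple_quotient_def ..
  then show ?thesis by (intro that[of F]) (simp_all add: subset_eq)
qed

lemma semisimple_quotient_mono:
  assumes "semisimple_quotient K" "K \<subseteq> K'"
  shows "semisimple_quotient K'"
proof -
  obtain F where F: "finite F" "\<forall>I\<in>F. maximal_or_unit I"
    "\<forall>f\<in>dual scale. (\<forall>I\<in>F. f \<in> I) \<longrightarrow> f \<in> K"
    by (rule semisimple_quotientE[OF assms(1)])
  show ?thesis by (rule semisimple_quotientI[OF F(1)]) (use F(2,3) assms(2) in \<open>simp_all add: subset_eq\<close>)
qed

lemma semisimple_quotient_dual: "dual scale \<subseteq> K \<Longrightarrow> semisimple_quotient K"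
  by (rule semisimple_quotientI[of "{}"]) (simp_all add: subset_eq)

lemma semisimple_quotient_Int:
  assumes "semisimple_quotient K" "semisimple_quotient K'"
  shows "semisimple_quotient (K \<inter> K')"
proof -
  obtain F where F: "finite F" "\<forall>I\<in>F. maximal_or_unit I"
    "\<forall>f\<in>dual scale. (\<forall>I\<in>F. f \<in> I) \<longrightarrow> f \<in> K"
    by (rule semisimple_quotientE[OF assms(1)])
  obtain F' where F': "finite F'" "\<forall>I\<in>F'. maximal_or_unit I"
    "\<forall>f\<in>dual scale. (\<forall>I\<in>F'. f \<in> I) \<longrightarrow> f \<in> K'"
    by (rule semisimple_quotientE[OF assms(2)])
  show ?thesis
    by (rule semisimple_quotientI[of "F \<union> F'"]) (use F F' in auto)
qed

lemma left_ideal_ann_mod: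
  assumes "left_submod L"
  shows "left_ideal (ann_mod L x)"
proof -
  have "(\<lambda>_. 0) \<rhd> x = 0" using scale_lact[OF counit_dual, of 0 x] by simp
  then show ?thesis
    using assms unfolding left_ideal_def ann_mod_def left_submod_def
    by (auto simp: dual_zero_mem dual_add_mem add_lact conv_dual conv_lact)
qed

text \<open>
  The colon ideal \<open>{f. f \<star> g \<in> I}\<close> is the annihilator of the class of \<open>g\<close> modulo \<open>I\<close>. As that
  quotient is simple, \<open>g\<close> can be recovered from \<open>f \<star> g\<close>: if \<open>u \<star> f \<star> g\<close> is congruent to the unit
  then \<open>g \<star> u \<star> f \<star> g\<close> is congruent to \<open>g\<close>, so \<open>g \<star> u \<star> f\<close> is congruent to the unit modulo the
  colon ideal.
\<close>

lemma maximal_or_unit_colon: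
  assumes I: "maximal_or_unit I" and g: "g \<in> dual scale"
  shows "maximal_or_unit {f \<in> dual scale. f \<star> g \<in> I}"
proof -
  have LI: "left_ideal I" using I by (simp add: maximal_or_unit_def)
  have sum: "(\<lambda>c. f c + h c) \<star> g = (\<lambda>c. (f \<star> g) c + (h \<star> g) c)"
    "(\<lambda>c. f c - h c) \<star> g = (\<lambda>c. (f \<star> g) c - (h \<star> g) c)" "(\<lambda>_. 0) \<star> g = (\<lambda>_. 0)" for f h
    by (simp_all add: conv_def)
  have "left_ideal {f \<in> dual scale. f \<star> g \<in> I}"
    using LI unfolding left_ideal_def
    by (auto simp: dual_zero_mem dual_add_mem conv_dual sum conv_assoc g)
  moreover have "\<exists>u\<in>dual scale. (\<lambda>c. (u \<star> f) c - \<epsilon> c) \<in> {f \<in> dual scale. f \<star> g \<in> I}"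
    if f: "f \<in> dual scale" "f \<star> g \<notin> I" for f
  proof -
    obtain u where u: "u \<in> dual scale" "(\<lambda>c. (u \<star> (f \<star> g)) c - \<epsilon> c) \<in> I"
      by (rule maximal_or_unit_inverse[OF I conv_dual[OF f(1) g] f(2)])
    have "g \<star> (\<lambda>c. (u \<star> (f \<star> g)) c - \<epsilon> c) \<in> I"
      by (rule left_idealD(3)[OF LI g u(2)])
    have gu: "g \<star> u \<in> dual scale" using g u(1) by (rule conv_dual)
    \<comment> \<open>\<open>g \<star> u\<close> is the witness for \<open>f\<close>.\<close>
    have "(\<lambda>c. (g \<star> u \<star> f \<star> g) c - (\<epsilon> \<star> g) c) = g \<star> (\<lambda>c. (u \<star> (f \<star> g)) c - \<epsilon> c)"
    proof
      fix c
      have "g \<star> u \<star> f \<star> g = g \<star> (u \<star> (f \<star> g))"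
        using g u f by (simp add: conv_assoc conv_dual)
      then show "(g \<star> u \<star> f \<star> g) c - (\<epsilon> \<star> g) c = (g \<star> (\<lambda>c. (u \<star> (f \<star> g)) c - \<epsilon> c)) c"
        using g u f by (simp add: conv_def[of g] diff_lact conv_dual counit_dual counit_lact
            dual_diff counit_conv)
    qed
    then show ?thesis
      using \<open>g \<star> _ \<in> I\<close> gu f g by (intro bexI[of _ "g \<star> u"])
        (auto simp: sum conv_dual counit_dual intro!: dual_diff_mem)
  qed
  ultimately show ?thesis unfolding maximal_or_unit_def by auto
qed

lemma semisimple_quotient_colon:
  assumes "semisimple_quotient K" and g: "g \<in> dual scale"
  shows "semisimple_quotient {f \<in> dual scale. f \<star> g \<in> K}"
proof -
  obtain F where F: "finite F" "\<forall>I\<in>F. maximal_or_unit I"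
    "\<forall>f\<in>dual scale. (\<forall>I\<in>F. f \<in> I) \<longrightarrow> f \<in> K"
    by (rule semisimple_quotientE[OF assms(1)])
  show ?thesis
  proof (rule semisimple_quotientI)
    show "finite ((\<lambda>I. {f \<in> dual scale. f \<star> g \<in> I}) ` F)" using F(1) by simp
    show "maximal_or_unit J" if "J \<in> (\<lambda>I. {f \<in> dual scale. f \<star> g \<in> I}) ` F" for J
      using that F(2) maximal_or_unit_colon[OF _ g] by auto
    show "f \<in> {f \<in> dual scale. f \<star> g \<in> K}"
      if "f \<in> dual scale" "\<forall>J\<in>(\<lambda>I. {f \<in> dual scale. f \<star> g \<in> I}) ` F. f \<in> J" for f
      using that F(3)[rule_format, OF conv_dual[OF that(1) g]] by simp
  qed
qed

definition cyclic_over :: "'c set \<Rightarrow> 'c \<Rightarrow> 'c set"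
  where "cyclic_over L x = {(f \<rhd> x) + l | f l. f \<in> dual scale \<and> l \<in> L}"

lemma cyclic_overI:
  assumes "f \<in> dual scale" "l \<in> L" "y = (f \<rhd> x) + l"
  shows "y \<in> cyclic_over L x"
  unfolding cyclic_over_def mem_Collect_eq
  by (intro exI[of _ f] exI[of _ l] conjI assms)

lemma cyclic_overE:
  assumes "y \<in> cyclic_over L x"
  obtains f l where "f \<in> dual scale" "l \<in> L" "y = (f \<rhd> x) + l"
  using assms by (auto simp: cyclic_over_def)

lemma left_submod_cyclic_over:
  assumes L: "left_submod L"
  shows "left_submod (cyclic_over L x)"
  unfolding left_submod_def
proof (intro conjI ballI)
  show "0 \<in> cyclic_over L x"
    using scale_lact[OF counit_dual, of 0 x]
    by (intro cyclic_overI[OF dual_zero_mem left_submodD(1)[OF L]]) simp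
  fix y assume "y \<in> cyclic_over L x"
  then obtain f l where y: "f \<in> dual scale" "l \<in> L" "y = (f \<rhd> x) + l" by (rule cyclic_overE)
  show "y + z \<in> cyclic_over L x" if z: "z \<in> cyclic_over L x" for z
  proof -
    obtain g m where z: "g \<in> dual scale" "m \<in> L" "z = (g \<rhd> x) + m"
      using z by (rule cyclic_overE)
    show ?thesis
      by (rule cyclic_overI[OF dual_add_mem[OF y(1) z(1)] left_submodD(2)[OF L y(2) z(2)]])
        (use y z in \<open>simp add: add_lact algebra_simps\<close>)
  qed
  show "g \<rhd> y \<in> cyclic_over L x" if g: "g \<in> dual scale" for g
    by (rule cyclic_overI[OF conv_dual[OF g y(1)] left_submodD(3)[OF L g y(2)]])
      (use y g in \<open>simp add: lact_add conv_lact\<close>)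
qed

lemma subset_cyclic_over: "L \<subseteq> cyclic_over L x"
proof
  fix l assume "l \<in> L"
  then show "l \<in> cyclic_over L x"
    using scale_lact[OF counit_dual, of 0 x] by (intro cyclic_overI[OF dual_zero_mem]) simp_all
qed

lemma mem_cyclic_over: "left_submod L \<Longrightarrow> x \<in> cyclic_over L x"
  by (rule cyclic_overI[OF counit_dual left_submodD(1)]) (simp_all add: counit_lact)

lemma cyclic_over_subset:
  assumes "left_submod D" "L \<subseteq> D" "x \<in> D"
  shows "cyclic_over L x \<subseteq> D"
  using assms left_submodD(2,3)[OF assms(1)] by (auto elim!: cyclic_overE)

text \<open>
  If \<open>f \<cdot> s\<close> is not in \<open>L\<close>, it generates \<open>S\<close> over \<open>L\<close> by simplicity, so some \<open>u\<close> brings it back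
  to \<open>s\<close>.
\<close>

lemma maximal_or_unit_ann_mod:
  assumes L: "left_submod L" and S: "covers S L" and s: "s \<in> S"
  shows "maximal_or_unit (ann_mod L s)"
proof -
  have "\<exists>u\<in>dual scale. (\<lambda>c. (u \<star> f) c - \<epsilon> c) \<in> ann_mod L s"
    if f: "f \<in> dual scale" "f \<notin> ann_mod L s" for f
  proof -
    let ?T = "cyclic_over L (f \<rhd> s)"
    have "left_submod S" "L \<subseteq> S" using S by (auto simp: covers_def)
    then have "?T \<subseteq> S"
      using s f(1) by (intro cyclic_over_subset left_submodD(3))
    moreover have "f \<rhd> s \<in> ?T" using L by (rule mem_cyclic_over)
    moreover have "f \<rhd> s \<notin> L" using f by (simp add: ann_mod_def)
    ultimately have "?T = S"
      using S left_submod_cyclic_over[OF L] subset_cyclic_over unfolding covers_def by metis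
    then have "s \<in> ?T" using s by simp
    then obtain u l where u: "u \<in> dual scale" "l \<in> L" "s = (u \<rhd> f \<rhd> s) + l"
      by (rule cyclic_overE)
    have "(\<lambda>c. (u \<star> f) c - \<epsilon> c) \<rhd> s = (u \<rhd> f \<rhd> s) - s"
      using u f by (simp add: diff_lact conv_dual counit_dual counit_lact conv_lact)
    also have "\<dots> = - l" using u(3) by (simp add: algebra_simps)
    also have "\<dots> \<in> L" using subspace_neg[OF left_submod_subspace[OF L] u(2)] .
    finally show ?thesis
      using u(1) f(1) by (intro bexI[of _ u]) (auto simp: ann_mod_def intro!: dual_diff_mem conv_dual counit_dual)
  qed
  then show ?thesis
    using left_ideal_ann_mod[OF L] unfolding maximal_or_unit_def by blast
qed

text \<open>
  Conversely, a cyclic module whose annihilator contains a maximal left ideal is simple or zero.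
\<close>

lemma cyclic_covers:
  assumes L: "left_submod L" and I: "maximal_or_unit I" "I \<subseteq> ann_mod L x" and x: "x \<notin> L"
  shows "covers (cyclic_over L x) L"
proof -
  have "T = L \<or> T = cyclic_over L x"
    if T: "left_submod T" "L \<subseteq> T" "T \<subseteq> cyclic_over L x" for T
  proof (subst disj_commute, rule disjCI)
    assume "T \<noteq> L"
    then obtain t where t: "t \<in> T" "t \<notin> L" using T(2) by blast
    then have "t \<in> cyclic_over L x" using T(3) by blast
    then obtain f l where f: "f \<in> dual scale" "l \<in> L" "t = (f \<rhd> x) + l"
      by (rule cyclic_overE)
    have "f \<rhd> x \<notin> L" using t(2) f left_submodD(2)[OF L] by blast
    then have "f \<notin> I" using I(2) by (auto simp: ann_mod_def)
    then obtain u where u: "u \<in> dual scale" "(\<lambda>c. (u \<star> f) c - \<epsilon> c) \<in> I"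
      by (rule maximal_or_unit_inverse[OF I(1) f(1)])
    have "(\<lambda>c. (u \<star> f) c - \<epsilon> c) \<rhd> x \<in> L" using I(2) u(2) by (auto simp: ann_mod_def)
    then have "(u \<rhd> f \<rhd> x) - x \<in> T"
      using u f T(2) by (auto simp: diff_lact conv_dual counit_dual counit_lact conv_lact)
    moreover have "u \<rhd> (t - l) \<in> T"
      using left_submodD(3,4)[OF T(1)] t(1) f(2) T(2) u(1) by blast
    ultimately have "u \<rhd> (t - l) - ((u \<rhd> f \<rhd> x) - x) \<in> T"
      by (rule left_submodD(4)[OF T(1), rotated])
    then have "x \<in> T" using f(3) by simp
    then show "T = cyclic_over L x" using cyclic_over_subset[OF T(1,2)] T(3) by (intro subset_antisym)
  qed
  moreover have "L \<subset> cyclic_over L x"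
    using subset_cyclic_over[of L x] mem_cyclic_over[OF L, of x] x by auto
  ultimately show ?thesis
    using left_submod_cyclic_over[OF L] unfolding covers_def by simp
qed

text \<open>
  If the annihilator of the class of \<open>x\<close> contains a finite intersection of maximal left ideals,
  then \<open>x\<close> is a sum of elements of simple submodules. The induction splits off one ideal \<open>I\<close>, in
  the manner of the Chinese remainder theorem: when the intersection of the others is not inside
  \<open>I\<close>, it contains some \<open>e\<close> congruent to the unit modulo \<open>I\<close>. Then \<open>e \<cdot> x\<close> is annihilated by
  \<open>I\<close>, hence generates a simple module, and \<open>x - e \<cdot> x\<close> is annihilated by the intersection of
  the others.
\<close>

lemma mem_of_semisimple_quotient:
  assumes L: "left_submod L" and N: "left_submod N" "L \<subseteq> N" and D: "left_submod D" "L \<subseteq> D"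
    and cov: "\<And>S. covers S L \<Longrightarrow> S \<subseteq> D \<Longrightarrow> S \<subseteq> N"
    and F: "finite F" "\<And>I. I \<in> F \<Longrightarrow> maximal_or_unit I"
    and x: "x \<in> D" "{f \<in> dual scale. \<forall>I\<in>F. f \<in> I} \<subseteq> ann_mod L x"
  shows "x \<in> N"
  using F x
proof (induct F arbitrary: x rule: finite_induct)
  case empty
  then have "\<epsilon> \<rhd> x \<in> L" using counit_dual by (auto simp: ann_mod_def)
  then show ?case using N(2) by (auto simp: counit_lact)
next
  case (insert I F)
  have LI: "left_ideal J" if "J \<in> insert I F" for J
    using insert.prems(1)[OF that] by (simp add: maximal_or_unit_def)
  have maxI: "maximal_or_unit I" using insert.prems(1) by blast
  have IH: "y \<in> N" if "y \<in> D" "{f \<in> dual scale. \<forall>J\<in>F. f \<in> J} \<subseteq> ann_mod L y" for y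
    using insert.prems(1) that by (intro insert.hyps(3)) simp_all
  show ?case
  proof (cases "{f \<in> dual scale. \<forall>J\<in>F. f \<in> J} \<subseteq> I")
    case True
    then have "{f \<in> dual scale. \<forall>J\<in>F. f \<in> J} \<subseteq> ann_mod L x"
      using insert.prems(3) by (simp add: subset_eq)
    then show ?thesis by (rule IH[OF insert.prems(2)])
  next
    case False
    then obtain d where d: "d \<in> dual scale" "\<forall>J\<in>F. d \<in> J" "d \<notin> I" by (auto simp: subset_eq)
    obtain u where u: "u \<in> dual scale" "(\<lambda>c. (u \<star> d) c - \<epsilon> c) \<in> I"
      by (rule maximal_or_unit_inverse[OF maxI d(1,3)])
    define e where "e = u \<star> d"
    define e' where "e' = (\<lambda>c. e c - \<epsilon> c)"
    have e: "e \<in> dual scale" "\<forall>J\<in>F. e \<in> J"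
      using d u left_idealD(3)[OF LI] by (simp_all add: e_def conv_dual)
    have e': "e' \<in> I" "e' \<in> dual scale"
      using u e by (auto simp: e'_def e_def intro!: dual_diff_mem counit_dual)
    have conv_e': "f \<star> e' = (\<lambda>c. (f \<star> e) c - f c)" if "f \<in> dual scale" for f
      using that e by (simp add: e'_def conv_def diff_lact counit_dual counit_lact dual_diff)
    have fe: "f \<star> e = (\<lambda>c. (f \<star> e') c + f c)" if "f \<in> dual scale" for f
      by (simp add: conv_e'[OF that])
    have "{f \<in> dual scale. \<forall>J\<in>F. f \<in> J} \<subseteq> ann_mod L (e' \<rhd> x)"
    proof
      fix f assume f: "f \<in> {f \<in> dual scale. \<forall>J\<in>F. f \<in> J}"
      then have "f \<star> e' \<in> I" using left_idealD(3)[OF LI[of I]] e' by simp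
      moreover have "f \<star> e' \<in> J" if J: "J \<in> F" for J
      proof -
        have "f \<star> e \<in> J" using left_idealD(3)[OF LI[of J]] J f e by simp
        then show ?thesis using left_ideal_diff[OF LI[of J], of "f \<star> e" f] J f by (simp add: conv_e')
      qed
      ultimately have "f \<star> e' \<in> ann_mod L x"
        using insert.prems(3) f e'(2) by (auto simp: conv_dual)
      then show "f \<in> ann_mod L (e' \<rhd> x)" using f e' by (simp add: ann_mod_def conv_lact)
    qed
    moreover have "e' \<rhd> x \<in> D" using left_submodD(3)[OF D(1) e'(2) insert.prems(2)] .
    ultimately have 1: "e' \<rhd> x \<in> N" by (intro IH)
    have annI: "I \<subseteq> ann_mod L (e \<rhd> x)"
    proof
      fix f assume f: "f \<in> I"
      then have fd: "f \<in> dual scale" using left_idealD(1)[OF LI[of I]] by simp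
      have "f \<star> e' \<in> I" using left_idealD(3)[OF LI[of I]] e' fd by simp
      then have "f \<star> e \<in> I"
        unfolding fe[OF fd] using left_idealD(2)[OF LI[of I]] f by simp
      moreover have "f \<star> e \<in> J" if J: "J \<in> F" for J
        using left_idealD(3)[OF LI[of J]] J fd e by simp
      ultimately have "f \<star> e \<in> ann_mod L x"
        using insert.prems(3) fd e(1) by (auto simp: conv_dual)
      then show "f \<in> ann_mod L (e \<rhd> x)" using fd e by (simp add: ann_mod_def conv_lact)
    qed
    have 2: "e \<rhd> x \<in> N"
    proof (cases "e \<rhd> x \<in> L")
      case True then show ?thesis using N(2) by blast
    next
      case False
      have "covers (cyclic_over L (e \<rhd> x)) L" by (rule cyclic_covers[OF L maxI annI False])
      moreover have "cyclic_over L (e \<rhd> x) \<subseteq> D"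
        using D insert.prems(2) e(1) by (intro cyclic_over_subset left_submodD(3))
      ultimately show ?thesis using cov mem_cyclic_over[OF L] by blast
    qed
    have "x = (e \<rhd> x) - (e' \<rhd> x)"
      using e by (simp add: e'_def diff_lact counit_dual counit_lact)
    also have "\<dots> \<in> N" using subspace_diff[OF left_submod_subspace[OF N(1)] 2 1] .
    finally show ?thesis .
  qed
qed

text \<open>Sums correspond to intersections of annihilators and the action to colon ideals.\<close>

lemma left_submod_semisimple_quotient:
  assumes L: "left_submod L"
  shows "left_submod {x. semisimple_quotient (ann_mod L x)}"
  unfolding left_submod_def mem_Collect_eq
proof (intro conjI ballI)
  show "semisimple_quotient (ann_mod L 0)"
    using L by (intro semisimple_quotient_dual) (auto simp: ann_mod_def lact_zero left_submod_def)
  fix x assume x: "x \<in> {x. semisimple_quotient (ann_mod L x)}"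
  show "semisimple_quotient (ann_mod L (x + y))" if "y \<in> {x. semisimple_quotient (ann_mod L x)}" for y
  proof (rule semisimple_quotient_mono[OF semisimple_quotient_Int])
    show "ann_mod L x \<inter> ann_mod L y \<subseteq> ann_mod L (x + y)"
      using L by (auto simp: ann_mod_def left_submod_def lact_add)
  qed (use x that in auto)
  show "semisimple_quotient (ann_mod L (g \<rhd> x))" if g: "g \<in> dual scale" for g
  proof (rule semisimple_quotient_mono[OF semisimple_quotient_colon])
    show "{f \<in> dual scale. f \<star> g \<in> ann_mod L x} \<subseteq> ann_mod L (g \<rhd> x)"
      using g by (auto simp: ann_mod_def conv_lact)
  qed (use x g in auto)
qed

text \<open>
  The set on the right is a submodule that contains all covers of \<open>L\<close>, since these have maximal
  annihilators, and \<open>mem_of_semisimple_quotient\<close> shows that it is the least one.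
\<close>

lemma socle_over_eq:
  assumes D: "left_submod D" and L: "left_submod L" "L \<subseteq> D"
  shows "socle_over L D = {x \<in> D. semisimple_quotient (ann_mod L x)}" (is "_ = ?R")
proof
  have "left_submod ?R"
    using D left_submod_semisimple_quotient[OF L(1)] unfolding left_submod_def by simp
  moreover have LR: "L \<subseteq> ?R"
    using L by (auto intro!: semisimple_quotient_dual simp: ann_mod_def left_submod_def)
  moreover have "S \<subseteq> ?R" if "covers S L" "S \<subseteq> D" for S
  proof
    fix s assume "s \<in> S"
    then have "maximal_or_unit (ann_mod L s)" using maximal_or_unit_ann_mod L(1) that(1) by blast
    then have "semisimple_quotient (ann_mod L s)"
      by (intro semisimple_quotientI[of "{ann_mod L s}"]) simp_all
    then show "s \<in> ?R" using \<open>s \<in> S\<close> that(2) by blast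
  qed
  ultimately show "socle_over L D \<subseteq> ?R" unfolding socle_over_def by blast
  show "?R \<subseteq> socle_over L D"
    unfolding socle_over_def
  proof (intro subsetI InterI, clarify)
    fix x N
    assume x: "x \<in> D" "semisimple_quotient (ann_mod L x)" and N: "left_submod N" "L \<subseteq> N"
      "\<forall>S. covers S L \<and> S \<subseteq> D \<longrightarrow> S \<subseteq> N"
    obtain F where F: "finite F" "\<forall>I\<in>F. maximal_or_unit I"
      "\<forall>f\<in>dual scale. (\<forall>I\<in>F. f \<in> I) \<longrightarrow> f \<in> ann_mod L x"
      by (rule semisimple_quotientE[OF x(2)])
    have cov: "S \<subseteq> N" if "covers S L" "S \<subseteq> D" for S using N(3) that by simp
    show "x \<in> N"
      by (rule mem_of_semisimple_quotient[OF L(1) N(1,2) D L(2) cov F(1) F(2)[rule_format] x(1)]) (use F(3) in auto)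
  qed
qed

section \<open>Loewy lengths and the coradical filtration\<close>

text \<open>
  The Loewy series of \<open>C\<close>, shifted by one against the coradical filtration: \<open>filtration n\<close> is
  \<open>C\<^sub>n\<^sub>-\<^sub>1\<close>. It is defined by the ideal condition so that the series of all submodules of \<open>C\<close> can
  be read off from it.
\<close>

primrec filtration :: "nat \<Rightarrow> 'c set"
  where
    "filtration 0 = {0}"
  | "filtration (Suc n) = {x. semisimple_quotient (ann_mod (filtration n) x)}"

lemma left_submod_filtration: "left_submod (filtration n)"
  by (induct n) (simp_all add: left_submod_zero left_submod_semisimple_quotient)

lemma filtration_Suc_mono: "filtration n \<subseteq> filtration (Suc n)"
  using left_submod_filtration[of n]
  by (auto intro!: semisimple_quotient_dual simp: ann_mod_def left_submod_def)

lemma filtration_mono: "m \<le> n \<Longrightarrow> filtration m \<subseteq> filtration n"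
  by (rule lift_Suc_mono_le[of filtration, OF filtration_Suc_mono])

lemma left_submod_Int: "left_submod L \<Longrightarrow> left_submod D \<Longrightarrow> left_submod (L \<inter> D)"
  by (simp add: left_submod_def)

text \<open>
  For \<open>x \<in> D\<close> the annihilators modulo \<open>L\<close> and modulo \<open>L \<inter> D\<close> coincide, so the socle does not
  depend on how \<open>D\<close> sits inside \<open>C\<close>.
\<close>

lemma socle_over_Int:
  assumes D: "left_submod D" and L: "left_submod L"
  shows "socle_over (L \<inter> D) D = {x \<in> D. semisimple_quotient (ann_mod L x)}"
proof -
  have "ann_mod (L \<inter> D) x = ann_mod L x" if "x \<in> D" for x
    using left_submodD(3)[OF D] that by (auto simp: ann_mod_def)
  then show ?thesis
    unfolding socle_over_eq[OF D left_submod_Int[OF L D] Int_lower2] by auto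
qed

lemma loewy_series_eq:
  assumes D: "left_submod D"
  shows "loewy_series (left_module scale \<Delta> D) n = filtration n \<inter> D"
proof (induct n)
  case 0
  then show ?case using D by (auto simp: left_module_def left_submod_def)
next
  case (Suc n)
  have sub: "left_submod (filtration n \<inter> D)"
    by (rule left_submod_Int[OF left_submod_filtration D])
  have "socle_over (filtration n \<inter> D) D \<subseteq> D"
    unfolding socle_over_Int[OF D left_submod_filtration] by auto
  then have "loewy_series (left_module scale \<Delta> D) (Suc n) = socle_over (filtration n \<inter> D) D"
    using Suc socle_quot_module[OF D sub Int_lower2] by (auto simp: left_module_def)
  then show ?case unfolding socle_over_Int[OF D left_submod_filtration] by auto
qed

lemma left_submod_UNIV: "left_submod UNIV"
  by (simp add: left_submod_def)

lemma coradical_eq: "coradical scale \<Delta> = filtration 1"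
  by (simp add: coradical_def socle_left_module socle_over_eq[OF left_submod_UNIV left_submod_zero])

text \<open>
  Right actions commute with left ones, hence are endomorphisms of the left module \<open>C\<close>, and
  endomorphisms only enlarge annihilators.
\<close>

lemma filtration_ract:
  assumes "g \<in> dual scale" "x \<in> filtration n"
  shows "x \<lhd> g \<in> filtration n"
  using assms(2)
proof (induct n arbitrary: x)
  case 0 then show ?case by (simp add: ract_zero assms(1))
next
  case (Suc n)
  have "ann_mod (filtration n) x \<subseteq> ann_mod (filtration n) (x \<lhd> g)"
    using Suc(1) assms(1) by (auto simp: ann_mod_def lact_ract_commute[symmetric])
  then show ?case using Suc(2) semisimple_quotient_mono by simp
qed

lemma gen_subcoalgebra_subset:
  assumes "x \<in> filtration n"
  shows "gen_subcoalgebra scale \<Delta> x \<subseteq> filtration n"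
  unfolding gen_subcoalgebra_def
proof (rule span_minimal)
  show "subspace (filtration n)" by (rule left_submod_subspace[OF left_submod_filtration])
  show "{(f \<rhd> x) \<lhd> g | f g. f \<in> dual scale \<and> g \<in> dual scale} \<subseteq> filtration n"
    using assms left_submod_filtration[of n] filtration_ract unfolding left_submod_def by blast
qed

lemma mem_gen_subcoalgebra: "x \<in> gen_subcoalgebra scale \<Delta> x"
proof -
  have "x = (\<epsilon> \<rhd> x) \<lhd> \<epsilon>" by (simp add: counit_lact ract_counit)
  then show ?thesis
    unfolding gen_subcoalgebra_def using counit_dual by (intro span_base) blast
qed

lemma left_submod_gen_subcoalgebra: "left_submod (gen_subcoalgebra scale \<Delta> x)"
proof -
  let ?X = "{(f \<rhd> x) \<lhd> g | f g. f \<in> dual scale \<and> g \<in> dual scale}"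
  have "h \<rhd> y \<in> span ?X" if h: "h \<in> dual scale" and y: "y \<in> span ?X" for h y
    using y
  proof (induct rule: span_induct_alt)
    case base show ?case by (simp add: lact_zero h span_zero)
  next
    case (step c y z)
    then obtain f g where y: "y = (f \<rhd> x) \<lhd> g" "f \<in> dual scale" "g \<in> dual scale" by blast
    have "h \<rhd> y = ((h \<star> f) \<rhd> x) \<lhd> g"
      using y h by (simp add: conv_lact lact_ract_commute)
    then have "h \<rhd> y \<in> span ?X" using y conv_dual[OF h] by (intro span_base) blast
    then show ?case using step h by (simp add: lact_add lact_scale span_add span_scale)
  qed
  then show ?thesis
    unfolding left_submod_def gen_subcoalgebra_def by (auto intro: span_zero span_add)
qed

text \<open>
  The fundamental theorem of coalgebras, from local finiteness on both sides. It is what makes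
  the Loewy series of this subcoalgebra reach the top.
\<close>

lemma gen_subcoalgebra_finite_dim:
  "\<exists>B. finite B \<and> gen_subcoalgebra scale \<Delta> x \<subseteq> span B"
proof -
  obtain B where B: "finite B" "\<And>f. f \<in> dual scale \<Longrightarrow> f \<rhd> x \<in> span B"
    using finite_dim_lact_orbit by metis
  obtain E where E: "\<And>b. finite (E b)" "\<And>b g. g \<in> dual scale \<Longrightarrow> b \<lhd> g \<in> span (E b)"
    using finite_dim_ract_orbit by metis
  have "y \<lhd> g \<in> span (\<Union>b\<in>B. E b)" if g: "g \<in> dual scale" and "y \<in> span B" for g y
    using that(2)
  proof (induct rule: span_induct_alt)
    case base show ?case by (simp add: ract_zero g span_zero)
  next
    case (step c b z)
    then have "b \<lhd> g \<in> span (\<Union>b\<in>B. E b)"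
      using E(2)[OF g, of b] span_mono[of "E b" "\<Union>b\<in>B. E b"] by blast
    then show ?case using step g by (simp add: ract_add ract_scale span_add span_scale)
  qed
  then have "gen_subcoalgebra scale \<Delta> x \<subseteq> span (\<Union>b\<in>B. E b)"
    unfolding gen_subcoalgebra_def using B(2) by (intro span_minimal) auto
  then show ?thesis using B(1) E(1) by blast
qed

text \<open>A submodule of least dimension strictly above \<open>L\<close> is a cover.\<close>

lemma covers_exists:
  assumes D: "left_submod D" "D \<subseteq> span B" "finite B" and L: "L \<subset> D"
  shows "\<exists>S. covers S L \<and> S \<subseteq> D"
proof -
  let ?P = "\<lambda>S. left_submod S \<and> L \<subset> S \<and> S \<subseteq> D"
  have "?P D" using D L by blast
  then obtain S where S: "?P S" "\<And>T. ?P T \<Longrightarrow> dim S \<le> dim T"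
    using ex_has_least_nat[of ?P D dim] by blast
  have "T = S" if T: "left_submod T" "L \<subset> T" "T \<subseteq> S" for T
  proof (rule ccontr)
    assume "T \<noteq> S"
    then have "dim T < dim S"
      using dim_strict_mono[OF left_submod_subspace[OF T(1)], of S B] T(3) S(1) D(2,3) by auto
    moreover have "dim S \<le> dim T" using S(1) T by (intro S(2)) auto
    ultimately show False by simp
  qed
  then show ?thesis using S(1) unfolding covers_def by blast
qed

text \<open>
  Below \<open>D\<close> the socle of the quotient is nonzero, so the dimension grows with each step and is
  bounded.
\<close>

lemma filtration_exhausts_finite:
  assumes D: "left_submod D" "D \<subseteq> span B" "finite B"
  shows "\<exists>n. D \<subseteq> filtration n"
proof (rule ccontr)
  assume "\<nexists>n. D \<subseteq> filtration n"
  then have no: "filtration n \<inter> D \<subset> D" for n by blast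
  have sub: "left_submod (filtration n \<inter> D)" for n
    by (rule left_submod_Int[OF left_submod_filtration D(1)])
  have "n \<le> dim (filtration n \<inter> D)" for n
  proof (induct n)
    case (Suc n)
    obtain S where S: "covers S (filtration n \<inter> D)" "S \<subseteq> D"
      using covers_exists[OF D no] by blast
    have "S \<subseteq> socle_over (filtration n \<inter> D) D"
      using S unfolding socle_over_def by blast
    also have "\<dots> = filtration (Suc n) \<inter> D"
      unfolding socle_over_Int[OF D(1) left_submod_filtration] by auto
    finally have "filtration n \<inter> D \<subset> filtration (Suc n) \<inter> D"
      using S(1) unfolding covers_def by blast
    then have "dim (filtration n \<inter> D) < dim (filtration (Suc n) \<inter> D)"
      using D(2,3) by (intro dim_strict_mono[OF left_submod_subspace[OF sub]]) auto
    then show ?case using Suc by simp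
  qed simp
  from this[of "Suc (card B)"] show False
    using dim_le_card[of "filtration (Suc (card B)) \<inter> D" B] D(2,3) by auto
qed

text \<open>
  The Loewy length of the generated subcoalgebra \<open>D\<close> is the least \<open>m\<close> with \<open>D \<subseteq> filtration m\<close>,
  and \<open>D\<close> is in a term of the filtration as soon as \<open>x\<close> is. Finite dimension guarantees that
  such an \<open>m\<close> exists, without which the least one would be an arbitrary number.
\<close>

lemma lw_le_iff: "lw scale \<Delta> x \<le> n \<longleftrightarrow> x \<in> filtration n"
proof -
  let ?D = "gen_subcoalgebra scale \<Delta> x"
  have series: "loewy_series (left_module scale \<Delta> ?D) m = mcarrier (left_module scale \<Delta> ?D)
      \<longleftrightarrow> ?D \<subseteq> filtration m" for m
    unfolding loewy_series_eq[OF left_submod_gen_subcoalgebra] by (auto simp: left_module_def)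
  have lw: "lw scale \<Delta> x = (LEAST m. ?D \<subseteq> filtration m)"
    unfolding lw_def loewy_length_def series ..
  have "\<exists>m. ?D \<subseteq> filtration m"
    using filtration_exhausts_finite[OF left_submod_gen_subcoalgebra] gen_subcoalgebra_finite_dim by blast
  then have "?D \<subseteq> filtration (lw scale \<Delta> x)" unfolding lw by (rule LeastI_ex)
  moreover have "lw scale \<Delta> x \<le> n" if "?D \<subseteq> filtration n"
    unfolding lw using that by (rule Least_le)
  ultimately show ?thesis
    using mem_gen_subcoalgebra[of x] gen_subcoalgebra_subset[of x n] filtration_mono[of "lw scale \<Delta> x" n] by blast
qed

text \<open>Apply the counit to \<open>f \<cdot> x\<close>.\<close>

lemma dual_zero_if_lact_zero: "f \<in> dual scale \<Longrightarrow> f \<rhd> x = 0 \<Longrightarrow> f x = 0"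
  using pairing_lact_ract[OF _ counit_dual, of f x] by (simp add: ract_counit dual_0 counit_dual)

text \<open>
  Let \<open>K\<close> be the annihilator of \<open>x\<close> modulo \<open>filtration n\<close>. It contains the functionals vanishing
  on the coradical \<open>C\<^sub>0\<close> by hypothesis, and those vanishing on some finite-dimensional space \<open>V\<close>.
  By \<open>dual_split\<close> it contains all functionals that vanish on \<open>C\<^sub>0 \<inter> V\<close>. This space is spanned by
  finitely many elements of the socle; the annihilator of each contains a finite intersection of
  maximal left ideals, and all these ideals together have their intersection in \<open>K\<close>.
\<close>

lemma filtration_SucI:
  assumes kill: "\<And>f. f \<in> perp scale (coradical scale \<Delta>) \<Longrightarrow> f \<rhd> x \<in> filtration n"
  shows "x \<in> filtration (Suc n)"
proof -
  note subF = left_submod_subspace[OF left_submod_filtration]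
  obtain B where B: "finite B" "\<And>f. f \<in> dual scale \<Longrightarrow> \<forall>b\<in>B. f b = 0 \<Longrightarrow> f \<rhd> x = 0"
    using lact_zero_if_zero_on_finite by metis
  have "subspace (filtration 1 \<inter> span B)" by (rule subspace_inter[OF subF subspace_span])
  then obtain E where E: "finite E" "E \<subseteq> filtration 1 \<inter> span B" "filtration 1 \<inter> span B = span E"
    using finite_spanning_subset[OF _ Int_lower2 B(1)] by metis
  have "\<exists>F. finite F \<and> (\<forall>I\<in>F. maximal_or_unit I) \<and>
      (\<forall>f\<in>dual scale. (\<forall>I\<in>F. f \<in> I) \<longrightarrow> f \<in> ann_mod {0} c)" if "c \<in> E" for c
  proof -
    have "semisimple_quotient (ann_mod {0} c)" using that E(2) by auto
    then obtain F where F: "finite F" "\<forall>I\<in>F. maximal_or_unit I"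
      "\<forall>f\<in>dual scale. (\<forall>I\<in>F. f \<in> I) \<longrightarrow> f \<in> ann_mod {0} c" by (rule semisimple_quotientE)
    show ?thesis by (intro exI[of _ F] conjI F)
  qed
  then obtain F where F: "\<forall>c\<in>E. finite (F c) \<and> (\<forall>I\<in>F c. maximal_or_unit I) \<and>
      (\<forall>f\<in>dual scale. (\<forall>I\<in>F c. f \<in> I) \<longrightarrow> f \<in> ann_mod {0} c)"
    using bchoice[of E] by (metis (no_types, lifting))
  have in_ann: "f \<in> ann_mod (filtration n) x"
    if f: "f \<in> dual scale" "\<forall>I\<in>\<Union>(F ` E). f \<in> I" for f
  proof -
    have "f c = 0" if "c \<in> E" for c
    proof -
      have "f \<in> ann_mod {0} c" using F that f by simp
      then show ?thesis using dual_zero_if_lact_zero[OF f(1), of c] by (simp add: ann_mod_def)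
    qed
    then have "f v = 0" if "v \<in> filtration 1" "v \<in> span B" for v
      using dual_zero_on_span[OF f(1), of E v] E(3) that by blast
    then obtain g where g: "g \<in> dual scale" "\<forall>s\<in>filtration 1. g s = 0" "\<forall>t\<in>span B. g t = f t"
      using dual_split[OF f(1) subF subspace_span] by blast
    have "g \<rhd> x \<in> filtration n"
      using kill[of g] g by (simp add: perp_def coradical_eq)
    moreover have "(\<lambda>c. f c - g c) \<rhd> x = 0"
      using g(3) by (intro B(2) dual_diff_mem f(1) g(1)) (simp add: span_base)
    ultimately show ?thesis
      using f(1) g(1) by (simp add: ann_mod_def diff_lact)
  qed
  have "finite (\<Union>(F ` E))" using E(1) F by auto
  moreover have "maximal_or_unit I" if "I \<in> \<Union>(F ` E)" for I using that F by auto
  ultimately have "semisimple_quotient (ann_mod (filtration n) x)"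
    using in_ann by (rule semisimple_quotientI)
  then show ?thesis by simp
qed

lemma unbounded_loewy_lengths_lact:
  fixes x :: "nat \<Rightarrow> 'c"
  assumes "\<not> bdd_above (range (\<lambda>n. lw scale \<Delta> (x n)))"
  shows "\<exists>a \<in> perp scale (coradical scale \<Delta>). \<not> bdd_above (range (\<lambda>n. lw scale \<Delta> (a \<rhd> x n)))"
proof (rule ccontr)
  assume "\<not> ?thesis"
  then have bdd: "\<exists>N. \<forall>n. a \<rhd> x n \<in> filtration N" if "a \<in> perp scale (coradical scale \<Delta>)" for a
    using that unfolding bdd_above_def by (auto simp: lw_le_iff)
  note subF = left_submod_subspace[OF left_submod_filtration]
  define W where "W N = span {x n \<lhd> h | n h. h \<in> perp scale (filtration N)}" for N
  \<comment> \<open>By the pairing, \<open>a\<close> vanishes on \<open>W N\<close> exactly if all \<open>a \<rhd> x n\<close> are in \<open>filtration N\<close>.\<close>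
  have "\<exists>N. W N \<subseteq> coradical scale \<Delta>"
  proof (rule chain_below_if_dual_killed)
    show "subspace (W N)" for N by (simp add: W_def)
    show "W (Suc N) \<subseteq> W N" for N
      unfolding W_def using filtration_mono[of N "Suc N"]
      by (intro span_mono) (auto simp: perp_def)
    show "subspace (coradical scale \<Delta>)" unfolding coradical_eq by (rule subF)
    fix a assume a: "a \<in> dual scale" "\<forall>s\<in>coradical scale \<Delta>. a s = 0"
    then obtain N where N: "\<And>n. a \<rhd> x n \<in> filtration N"
      using bdd[of a] by (auto simp: perp_def)
    have "a w = 0" if "w \<in> W N" for w
    proof (rule dual_zero_on_span[OF a(1) _ that[unfolded W_def]])
      fix b assume "b \<in> {x n \<lhd> h | n h. h \<in> perp scale (filtration N)}"
      then obtain n h where "b = x n \<lhd> h" "h \<in> perp scale (filtration N)" by blast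
      then show "a b = 0" using pairing_lact_ract[OF a(1), of h "x n"] N[of n] by (simp add: perp_def)
    qed
    then show "\<exists>N. \<forall>w\<in>W N. a w = 0" by blast
  qed
  then obtain N where N: "W N \<subseteq> coradical scale \<Delta>" by blast
  have "a \<rhd> x n \<in> filtration N" if a: "a \<in> perp scale (coradical scale \<Delta>)" for a n
  proof (rule ccontr)
    assume "a \<rhd> x n \<notin> filtration N"
    then obtain h where h: "h \<in> dual scale" "\<forall>s\<in>filtration N. h s = 0" "h (a \<rhd> x n) = 1"
      using dual_separates[OF subF] by blast
    have "x n \<lhd> h \<in> W N" unfolding W_def using h by (intro span_base) (auto simp: perp_def)
    then have "a (x n \<lhd> h) = 0" using N a by (auto simp: perp_def)
    then show False using pairing_lact_ract[of a h "x n"] a h by (simp add: perp_def)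
  qed
  then have "x n \<in> filtration (Suc N)" for n by (rule filtration_SucI)
  then have "bdd_above (range (\<lambda>n. lw scale \<Delta> (x n)))"
    unfolding bdd_above_def using lw_le_iff by blast
  then show False using assms by blast
qed

end

theorem lemma1p3:
  fixes scale :: "'k::field \<Rightarrow> 'c::ab_group_add \<Rightarrow> 'c"
    and \<Delta> :: "'c \<Rightarrow> ('c \<times> 'c \<Rightarrow>\<^sub>0 'k) set"
    and \<epsilon> :: "'c \<Rightarrow> 'k"
    and x :: "nat \<Rightarrow> 'c"
  assumes "coalgebra scale \<Delta> \<epsilon>"
    and "\<not> bdd_above (range (\<lambda>n. lw scale \<Delta> (x n)))"
  shows "\<exists>a \<in> dual scale. a \<in> perp scale (coradical scale \<Delta>) \<and>
    \<not> bdd_above (range (\<lambda>n. lw scale \<Delta> (lact scale \<Delta> a (x n))))"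
proof -
  interpret coalgebra scale \<Delta> \<epsilon> by (rule assms(1))
  show ?thesis using unbounded_loewy_lengths_lact[OF assms(2)] by (auto simp: perp_def)
qed

end
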